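(* Let $T$ be a compact torus acting continuously on a connected topological space $X$. Let $X_1:=\{p\in X\mid\operatorname{corank}T_p\le1\}$ be the 1-skeleton of the action. Assume that: 1. the action has only finitely many infinitesimal isotropies (i.e. the set $\{\mathfrak{t}_p\mid p\in X\}$ is finite); 2. for any subtorus $H\subset T$, any connected component of $X^H$ has non-empty intersection with $X^T$ and connected intersection with $X_1$; 3. if $\mathfrak{g}_1,\ldots,\mathfrak{g}_m$ are the infinitesimal isotropies of the action which have codimension one in $\mathfrak{t}$, then each of the spaces $X^T$ and $X^{\mathfrak{g}_i}:=\{p\in X\mid\mathfrak{g}_i\subset\mathfrak{t}_p\}$, $1\le i\le m$, has finitely many connected components. Let $Z_1,\ldots,Z_n$ be the connected components of $X^T$. Then the image of $\mathcal{A}_T(X)$ under the injective algebra homomorphism $r:\mathcal{A}_T(X)\to\mathcal{A}_T(X^T)$ (restriction) is the subalgebra of $\mathcal{A}_T(X^T)=\bigoplus_{r=1}^n\mathcal{A}_T(Z_r)=S(\mathfrak{t}^* )^n$ which consists of all $(f_1,\ldots,f_n)$ with the property that whenever $Z_r$ and $Z_s$ are contained in the same connected component of some $X^{\mathfrak{g}_i}$, $1\le i\le m$, the difference $f_r-f_s$ restricted to $\mathfrak{g}_i$ is identically zero.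
   Context: $\mathfrak{t}$ is the Lie algebra of $T$; for $p\in X$, $\mathfrak{t}_p\subset\mathfrak{t}$ is the Lie algebra of the isotropy group $T_p$ (the infinitesimal isotropy at $p$); $\operatorname{corank}T_p=\dim\mathfrak{t}-\dim\mathfrak{t}_p$. For a subspace $\mathfrak{h}\subset\mathfrak{t}$, $S(\mathfrak{h}^* )$ is the algebra of real polynomial functions on $\mathfrak{h}$. A (polynomial) assignment on a $T$-space $X$ is a map $A$ assigning to each $p\in X$ a polynomial $A(p)\in S(\mathfrak{t}_p^* )$ such that for every (connected) subtorus $H\subset T$ with Lie algebra $\mathfrak{h}$, the map $p\mapsto A(p)|_{\mathfrak{h}}$ is locally constant on the fixed point set $X^H$. $\mathcal{A}_T(X)$ denotes the set of all assignments, an $S(\mathfrak{t}^* )$-algebra with pointwise operations, $(fA)(p)=f|_{\mathfrak{t}_p}A(p)$. For a $T$-invariant subspace $Y\subset X$, the restriction map $\mathcal{A}_T(X)\to\mathcal{A}_T(Y)$ sends $A$ to $A|_Y$. On a non-empty connected space with trivial $T$-action any assignment is a constant element of $S(\mathfrak{t}^* )$, which gives the identification $\mathcal{A}_T(Z_r)=S(\mathfrak{t}^* )$. Subtori include the trivial subgroup and $T$ itself.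
   Formalization: The topological space X is additionally assumed to be Hausdorff; without a separation assumption the claim fails, e.g. for two 2-spheres with complementary circle isotropies glued in a non-Hausdorff (T_1) way along their equators. *)

theory Defs
  imports
    "HOL-Analysis.Analysis"
    "HOL-Algebra.Group_Action"
    "HOL-Algebra.Module"
    "HOL-Algebra.Subrings"
begin

section \<open>Tori and their Lie algebras\<close>

text \<open>The standard torus: the product of copies of the unit circle indexed by the finite type
  \<open>'n\<close>. The product and the unit of \<open>complex ^ 'n\<close> are the componentwise ones.\<close>

definition standard_torus :: "(complex ^ 'n) monoid" where
  "standard_torus = \<lparr>carrier = {z. \<forall>i. norm (z $ i) = 1}, monoid.mult = (*), one = 1\<rparr>"

text \<open>A compact torus is a compact connected abelian Lie group. Up to isomorphism these are exactly
  the compact connected subgroups of the standard tori. The zero-dimensional torus is included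
  (as the trivial subgroup). Applied to subgroups of a torus, the same predicate singles out its
  subtori.\<close>

definition torus :: "(complex ^ 'n) set \<Rightarrow> bool" where
  "torus H \<longleftrightarrow> subgroup H standard_torus \<and> compact H \<and> connected H"

abbreviation torus_group :: "(complex ^ 'n) set \<Rightarrow> (complex ^ 'n) monoid" where
  "torus_group T \<equiv> standard_torus\<lparr>carrier := T\<rparr>"

text \<open>The exponential map of the standard torus, whose Lie algebra is identified with
  \<open>real ^ 'n\<close>, and the Lie algebra of a closed subgroup.\<close>

definition torus_exp :: "real ^ 'n \<Rightarrow> complex ^ 'n" where
  "torus_exp v = (\<chi> i. cis (v $ i))"

definition lie :: "(complex ^ 'n) set \<Rightarrow> (real ^ 'n) set" where
  "lie H = {v. \<forall>s. torus_exp (s *\<^sub>R v) \<in> H}"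


section \<open>Torus actions\<close>

definition continuous_torus_action ::
    "(complex ^ 'n) set \<Rightarrow> 'x topology \<Rightarrow> (complex ^ 'n \<Rightarrow> 'x \<Rightarrow> 'x) \<Rightarrow> bool" where
  "continuous_torus_action T X \<phi> \<longleftrightarrow>
     group_action (torus_group T) (topspace X) \<phi> \<and>
     continuous_map (prod_topology (top_of_set T) X) X (\<lambda>(g, x). \<phi> g x)"

abbreviation isotropy ::
    "(complex ^ 'n) set \<Rightarrow> (complex ^ 'n \<Rightarrow> 'x \<Rightarrow> 'x) \<Rightarrow> 'x \<Rightarrow> (complex ^ 'n) set" where
  "isotropy T \<phi> p \<equiv> stabilizer (torus_group T) \<phi> p"

definition inf_isotropy ::
    "(complex ^ 'n) set \<Rightarrow> (complex ^ 'n \<Rightarrow> 'x \<Rightarrow> 'x) \<Rightarrow> 'x \<Rightarrow> (real ^ 'n) set" where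
  "inf_isotropy T \<phi> p = lie (isotropy T \<phi> p)"

definition inf_isotropies ::
    "(complex ^ 'n) set \<Rightarrow> 'x topology \<Rightarrow> (complex ^ 'n \<Rightarrow> 'x \<Rightarrow> 'x) \<Rightarrow> (real ^ 'n) set set" where
  "inf_isotropies T X \<phi> = inf_isotropy T \<phi> ` topspace X"

definition codim_in :: "(complex ^ 'n) set \<Rightarrow> (real ^ 'n) set \<Rightarrow> nat" where
  "codim_in T \<hh> = dim (lie T) - dim \<hh>"

definition one_skeleton ::
    "(complex ^ 'n) set \<Rightarrow> 'x topology \<Rightarrow> (complex ^ 'n \<Rightarrow> 'x \<Rightarrow> 'x) \<Rightarrow> 'x set" where
  "one_skeleton T X \<phi> = {p \<in> topspace X. codim_in T (inf_isotropy T \<phi> p) \<le> 1}"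

definition fixed_points ::
    "(complex ^ 'n) set \<Rightarrow> 'x topology \<Rightarrow> (complex ^ 'n \<Rightarrow> 'x \<Rightarrow> 'x) \<Rightarrow> (complex ^ 'n) set \<Rightarrow> 'x set"
  where "fixed_points T X \<phi> H = {p \<in> topspace X. H \<subseteq> isotropy T \<phi> p}"

definition inf_fixed_points ::
    "(complex ^ 'n) set \<Rightarrow> 'x topology \<Rightarrow> (complex ^ 'n \<Rightarrow> 'x \<Rightarrow> 'x) \<Rightarrow> (real ^ 'n) set \<Rightarrow> 'x set"
  where "inf_fixed_points T X \<phi> \<gg> = {p \<in> topspace X. \<gg> \<subseteq> inf_isotropy T \<phi> p}"


section \<open>Polynomial functions on a subspace\<close>

text \<open>The algebra of real polynomial functions on a linear subspace \<open>V\<close>. Its elements are functions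
  on \<open>V\<close>, represented extensionally. Since linear functionals on \<open>V\<close> extend to the ambient space, the
  polynomial functions on \<open>V\<close> are the restrictions of those on the ambient space.\<close>

definition poly_algebra :: "(real ^ 'n) set \<Rightarrow> (real ^ 'n \<Rightarrow> real) ring" where
  "poly_algebra V =
     \<lparr>carrier = {restrict f V | f. real_polynomial_function f},
      monoid.mult = (\<lambda>f g. \<lambda>v\<in>V. f v * g v),
      one = (\<lambda>v\<in>V. 1),
      zero = (\<lambda>v\<in>V. 0),
      add = (\<lambda>f g. \<lambda>v\<in>V. f v + g v)\<rparr>"


section \<open>Assignments\<close>

definition locally_constant_on :: "'a topology \<Rightarrow> ('a \<Rightarrow> 'b) \<Rightarrow> bool" where
  "locally_constant_on Y f \<longleftrightarrow>
     (\<forall>p \<in> topspace Y. \<exists>U. openin Y U \<and> p \<in> U \<and> (\<forall>q \<in> U. f q = f p))"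

text \<open>Here \<open>Y\<close> is a \<open>T\<close>-space, or a \<open>T\<close>-invariant subspace with the subspace topology of a space on
  which \<open>\<phi>\<close> is an action of \<open>T\<close>.\<close>

definition assignments ::
    "(complex ^ 'n) set \<Rightarrow> 'x topology \<Rightarrow> (complex ^ 'n \<Rightarrow> 'x \<Rightarrow> 'x) \<Rightarrow> ('x \<Rightarrow> real ^ 'n \<Rightarrow> real) set"
  where
  "assignments T Y \<phi> =
     {A \<in> (\<Pi>\<^sub>E p \<in> topspace Y. carrier (poly_algebra (inf_isotropy T \<phi> p))).
        \<forall>H. torus H \<and> H \<subseteq> T \<longrightarrow>
          locally_constant_on (subtopology Y (fixed_points T Y \<phi> H)) (\<lambda>p. restrict (A p) (lie H))}"

definition assignment_algebra ::
    "(complex ^ 'n) set \<Rightarrow> 'x topology \<Rightarrow> (complex ^ 'n \<Rightarrow> 'x \<Rightarrow> 'x) \<Rightarrow>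
      (real ^ 'n \<Rightarrow> real, 'x \<Rightarrow> real ^ 'n \<Rightarrow> real) module"
  where
  "assignment_algebra T Y \<phi> =
     \<lparr>carrier = assignments T Y \<phi>,
      monoid.mult = (\<lambda>A B. \<lambda>p\<in>topspace Y. A p \<otimes>\<^bsub>poly_algebra (inf_isotropy T \<phi> p)\<^esub> B p),
      one = (\<lambda>p\<in>topspace Y. \<one>\<^bsub>poly_algebra (inf_isotropy T \<phi> p)\<^esub>),
      zero = (\<lambda>p\<in>topspace Y. \<zero>\<^bsub>poly_algebra (inf_isotropy T \<phi> p)\<^esub>),
      add = (\<lambda>A B. \<lambda>p\<in>topspace Y. A p \<oplus>\<^bsub>poly_algebra (inf_isotropy T \<phi> p)\<^esub> B p),
      smult = (\<lambda>f A. \<lambda>p\<in>topspace Y.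
        restrict f (inf_isotropy T \<phi> p) \<otimes>\<^bsub>poly_algebra (inf_isotropy T \<phi> p)\<^esub> A p)\<rparr>"


section \<open>Algebras\<close>

text \<open>The power \<open>R\<^sup>J\<close> of a ring \<open>R\<close>, as an algebra over \<open>R\<close>.\<close>

definition power_algebra :: "'j set \<Rightarrow> 'a ring \<Rightarrow> ('a, 'j \<Rightarrow> 'a) module" where
  "power_algebra J R =
     \<lparr>carrier = (J \<rightarrow>\<^sub>E carrier R),
      monoid.mult = (\<lambda>f g. \<lambda>j\<in>J. f j \<otimes>\<^bsub>R\<^esub> g j),
      one = (\<lambda>j\<in>J. \<one>\<^bsub>R\<^esub>),
      zero = (\<lambda>j\<in>J. \<zero>\<^bsub>R\<^esub>),
      add = (\<lambda>f g. \<lambda>j\<in>J. f j \<oplus>\<^bsub>R\<^esub> g j),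
      smult = (\<lambda>a f. \<lambda>j\<in>J. a \<otimes>\<^bsub>R\<^esub> f j)\<rparr>"

definition algebra_hom :: "'a ring \<Rightarrow> ('a, 'b) module \<Rightarrow> ('a, 'c) module \<Rightarrow> ('b \<Rightarrow> 'c) set" where
  "algebra_hom R M N =
     {h \<in> ring_hom M N. \<forall>a \<in> carrier R. \<forall>x \<in> carrier M. h (a \<odot>\<^bsub>M\<^esub> x) = a \<odot>\<^bsub>N\<^esub> h x}"

definition algebra_iso :: "'a ring \<Rightarrow> ('a, 'b) module \<Rightarrow> ('a, 'c) module \<Rightarrow> ('b \<Rightarrow> 'c) set" where
  "algebra_iso R M N = {h \<in> algebra_hom R M N. bij_betw h (carrier M) (carrier N)}"

definition subalgebra_of :: "'a ring \<Rightarrow> 'b set \<Rightarrow> ('a, 'b) module \<Rightarrow> bool" where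
  "subalgebra_of R S M \<longleftrightarrow> subring S M \<and> (\<forall>a \<in> carrier R. \<forall>x \<in> S. a \<odot>\<^bsub>M\<^esub> x \<in> S)"


section \<open>Tuples of polynomials on the Lie algebra of the torus\<close>

text \<open>The identification of the assignments on \<open>X\<^sup>T\<close> with \<open>n\<close>-tuples of polynomials on the Lie algebra
  of \<open>T\<close>: an assignment on \<open>X\<^sup>T\<close> is constant on each component \<open>Z j\<close>, and goes to the tuple of these
  constant values.\<close>

definition component_values ::
    "nat \<Rightarrow> (nat \<Rightarrow> 'x set) \<Rightarrow> ('x \<Rightarrow> real ^ 'n \<Rightarrow> real) \<Rightarrow> nat \<Rightarrow> real ^ 'n \<Rightarrow> real" where
  "component_values n Z A = (\<lambda>j\<in>{1..n}. A (SOME p. p \<in> Z j))"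

definition compatible_tuples ::
    "(complex ^ 'n) set \<Rightarrow> 'x topology \<Rightarrow> (complex ^ 'n \<Rightarrow> 'x \<Rightarrow> 'x) \<Rightarrow> nat \<Rightarrow> (nat \<Rightarrow> 'x set) \<Rightarrow>
      (nat \<Rightarrow> real ^ 'n \<Rightarrow> real) set"
  where
  "compatible_tuples T X \<phi> n Z =
     {f \<in> {1..n} \<rightarrow>\<^sub>E carrier (poly_algebra (lie T)).
        \<forall>\<gg> \<in> inf_isotropies T X \<phi>. codim_in T \<gg> = 1 \<longrightarrow>
          (\<forall>C \<in> connected_components_of (subtopology X (inf_fixed_points T X \<phi> \<gg>)).
            \<forall>r \<in> {1..n}. \<forall>s \<in> {1..n}. Z r \<subseteq> C \<and> Z s \<subseteq> C \<longrightarrow>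
              (\<forall>v \<in> \<gg>. f r v - f s v = 0))}"

end

theory Submission
  imports Defs
begin

text \<open>Everything rests on two facts about an infinitesimal isotropy \<open>\<tt>\<^sub>p\<close>. It is the Lie algebra of a subtorus
\<open>exp \<tt>\<^sub>p\<close> of \<open>T\<close>, and a subtorus \<open>H\<close> fixes \<open>p\<close> exactly when its Lie algebra is contained in \<open>\<tt>\<^sub>p\<close>.
Both come from the structure of closed subgroups of a torus:
\<open>small_torus_exp_in_lie\<close> says that near \<open>0\<close> the exponential preimage of a closed subgroup is its Lie
algebra, so that \<open>exp (lie K)\<close> is open and closed in \<open>K\<close>. Hence the condition on an assignment \<open>A\<close>
at \<open>p\<close> may be read on the component of \<open>p\<close> in the fixed point set of \<open>exp \<tt>\<^sub>p\<close>, and there it says that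
\<open>A p\<close> is the restriction to \<open>\<tt>\<^sub>p\<close> of the value of \<open>A\<close> at any \<open>T\<close>-fixed point of that component.
As such a fixed point exists, \<open>A\<close> is determined by its values on the fixed points of \<open>T\<close>.
The same argument applied to a codimension one isotropy gives the compatibility of these values.

Conversely, let \<open>f\<close> be a compatible tuple. The crucial point is \<open>compatible_tuple_on_component\<close>: for an
arbitrary subtorus \<open>H\<close>, if two components \<open>Z i\<close> and \<open>Z j\<close> lie in the same component \<open>C\<close> of the fixed
point set of \<open>H\<close>, then \<open>f i\<close> and \<open>f j\<close> agree on the Lie algebra of \<open>H\<close>. Compatibility gives this
for the Lie algebras of codimension one isotropies only, and the connectedness of the intersection of \<open>C\<close> with the one-skeleton carries it to
all codimensions. That intersection is covered by finitely many closed sets, namely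
components of the fixed point set of \<open>T\<close> and of the fixed point sets of codimension one isotropies containing
\<open>lie H\<close>. To a point of it corresponds the polynomial \<open>f j\<close> restricted to \<open>lie H\<close>, where \<open>Z j\<close> lies in the
component through that point. This polynomial is constant on each of the closed sets, and a function that is
constant on the members of a finite closed cover of a connected space is constant.

It follows that the restriction of \<open>f j\<close> to \<open>\<tt>\<^sub>p\<close> is the same for every \<open>Z j\<close> in the component of \<open>p\<close> in the
fixed point set of \<open>exp \<tt>\<^sub>p\<close>. Sending \<open>p\<close> to it gives a map whose restriction to \<open>lie H\<close> is constant along
the components of the fixed point set of \<open>H\<close>, for every \<open>H\<close>. Since each of these components contains some
\<open>Z j\<close>, there are finitely many of them, so they are open, and the map is an assignment extending \<open>f\<close>.\<close>

section \<open>Closed subgroups of tori and their Lie algebras\<close>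

lemma group_standard_torus: "group (standard_torus :: (complex ^ 'n) monoid)"
proof (rule groupI)
  fix x :: "complex ^ 'n" assume x: "x \<in> carrier standard_torus"
  have "(\<chi> i. inverse (x $ i)) \<in> carrier standard_torus"
    using x by (simp add: standard_torus_def norm_inverse)
  moreover have "(\<chi> i. inverse (x $ i)) * x = 1"
  proof -
    have "x $ i \<noteq> 0" for i using x by (auto simp: standard_torus_def dest: spec[of _ i])
    then show ?thesis by (simp add: vec_eq_iff)
  qed
  ultimately show "\<exists>y\<in>carrier standard_torus. y \<otimes>\<^bsub>standard_torus\<^esub> x = \<one>\<^bsub>standard_torus\<^esub>"
    by (intro bexI[of _ "\<chi> i. inverse (x $ i)"]) (simp_all add: standard_torus_def)
qed (auto simp: standard_torus_def norm_mult mult.assoc)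

lemma torus_exp_add: "torus_exp (v + w) = torus_exp v * torus_exp w"
  by (simp add: torus_exp_def vec_eq_iff cis_mult)

lemma torus_exp_0 [simp]: "torus_exp 0 = 1"
  by (simp add: torus_exp_def vec_eq_iff)

lemma torus_exp_in_standard_torus [simp]: "torus_exp v \<in> carrier standard_torus"
  by (simp add: torus_exp_def standard_torus_def)

lemma inv_torus_exp: "inv\<^bsub>standard_torus\<^esub> (torus_exp v) = torus_exp (- v)"
proof (rule group.inv_equality[OF group_standard_torus])
  show "torus_exp (- v) \<otimes>\<^bsub>standard_torus\<^esub> torus_exp v = \<one>\<^bsub>standard_torus\<^esub>"
    using torus_exp_add[of "- v" v] by (simp add: standard_torus_def)
qed auto

lemma subgroup_mult:
  "\<lbrakk>subgroup K standard_torus; x \<in> K; y \<in> K\<rbrakk> \<Longrightarrow> x * y \<in> K"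
  using subgroup.m_closed[of K standard_torus x y] by (simp add: standard_torus_def)

lemma subgroup_one: "subgroup K standard_torus \<Longrightarrow> 1 \<in> K"
  using subgroup.one_closed[of K standard_torus] by (simp add: standard_torus_def)

lemma subgroup_torus_exp_minus:
  "\<lbrakk>subgroup K standard_torus; torus_exp v \<in> K\<rbrakk> \<Longrightarrow> torus_exp (- v) \<in> K"
  using subgroup.m_inv_closed[of K standard_torus "torus_exp v"] by (simp add: inv_torus_exp)

lemma torus_exp_of_int_mult_in_subgroup:
  assumes K: "subgroup K standard_torus" and v: "torus_exp v \<in> K"
  shows "torus_exp (of_int m *\<^sub>R v) \<in> K"
proof -
  have nat: "torus_exp (of_nat k *\<^sub>R v) \<in> K" for k
    by (induction k) (simp_all add: subgroup_one[OF K] scaleR_add_left torus_exp_add subgroup_mult[OF K] v)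
  show ?thesis
  proof (cases m)
    case (nonneg k)
    then show ?thesis using nat[of k] by simp
  next
    case (neg k)
    then have "of_int m *\<^sub>R v = - (of_nat (Suc k) *\<^sub>R v)"
      by (simp flip: scaleR_minus_left)
    then show ?thesis using subgroup_torus_exp_minus[OF K nat[of "Suc k"]] by simp
  qed
qed

lemma continuous_on_torus_exp: "continuous_on S torus_exp"
  unfolding torus_exp_def by (intro continuous_intros)

lemma subspace_lie:
  assumes "subgroup K standard_torus"
  shows "subspace (lie K)"
  unfolding subspace_def lie_def
  by (auto simp: subgroup_one[OF assms] scaleR_add_right torus_exp_add subgroup_mult[OF assms])

lemma lie_mono: "H \<subseteq> K \<Longrightarrow> lie H \<subseteq> lie K"
  by (auto simp: lie_def)

lemma torus_exp_lie_subset: "torus_exp ` lie K \<subseteq> K"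
  by (auto simp: lie_def dest: spec[of _ 1])

text \<open>The exponential preimage of \<open>K\<close> is a closed additive subgroup, and \<open>lie K\<close> is the largest linear subspace in it.
If the preimage had points outside \<open>lie K\<close> arbitrarily close to \<open>0\<close>, their components orthogonal to \<open>lie K\<close> would
still lie in it. Integer multiples of such short vectors approximate every multiple of a limit of their
directions, so that limit would span a line in the preimage and be orthogonal to \<open>lie K\<close>, a contradiction.\<close>
lemma small_torus_exp_in_lie:
  fixes K :: "(complex ^ 'n) set"
  assumes K: "subgroup K standard_torus" and "closed K"
  obtains \<epsilon> where "\<epsilon> > 0" "\<And>v. \<lbrakk>norm v < \<epsilon>; torus_exp v \<in> K\<rbrakk> \<Longrightarrow> v \<in> lie K"
proof (rule ccontr)
  assume "\<not> thesis"
  then have "\<forall>k::nat. \<exists>v. norm v < inverse (real (Suc k)) \<and> torus_exp v \<in> K \<and> v \<notin> lie K"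
    using that by (metis inverse_positive_iff_positive of_nat_0_less_iff zero_less_Suc)
  then obtain v where v: "\<And>k. norm (v k) < inverse (real (Suc k))"
      "\<And>k. torus_exp (v k) \<in> K" "\<And>k. v k \<notin> lie K"
    by metis
  have span: "span (lie K) = lie K"
    using subspace_lie[OF K] by (simp add: span_eq_iff)
  have "\<exists>b. torus_exp b \<in> K \<and> b \<noteq> 0 \<and> norm b \<le> norm (v k) \<and> (\<forall>w\<in>lie K. orthogonal b w)" for k
  proof -
    obtain a b where ab: "a \<in> lie K" "\<And>w. w \<in> lie K \<Longrightarrow> orthogonal b w" "v k = a + b"
      using orthogonal_subspace_decomp_exists[of "lie K" "v k"] span by metis
    have "b = v k + - a" using ab by simp
    moreover have "- a \<in> lie K" using subspace_lie[OF K] ab(1) by (simp add: subspace_neg)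
    ultimately have "torus_exp b \<in> K"
      using v(2)[of k] torus_exp_lie_subset[of K] subgroup_mult[OF K] by (metis image_subset_iff torus_exp_add)
    moreover have "b \<noteq> 0" using ab v(3)[of k] by auto
    moreover have "norm b \<le> norm (v k)"
    proof -
      have "norm (v k) ^ 2 = norm a ^ 2 + norm b ^ 2"
        using ab(1) ab(2)[of a] by (simp add: ab(3) norm_add_Pythagorean orthogonal_commute)
      then show ?thesis by (simp add: power2_le_imp_le)
    qed
    ultimately show ?thesis using ab(2) by blast
  qed
  then obtain b where b: "\<And>k. torus_exp (b k) \<in> K" "\<And>k. b k \<noteq> 0"
      "\<And>k. norm (b k) \<le> norm (v k)" "\<And>k w. w \<in> lie K \<Longrightarrow> orthogonal (b k) w"
    by metis
  have b_lim: "(\<lambda>k. norm (b k)) \<longlonglongrightarrow> 0"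
  proof (rule tendsto_sandwich[where f = "\<lambda>_. 0" and h = "\<lambda>k. inverse (real (Suc k))"])
    show "\<forall>\<^sub>F k in sequentially. norm (b k) \<le> inverse (real (Suc k))"
      using b(3) v(1) by (intro always_eventually) (meson less_eq_real_def order_trans)
    show "(\<lambda>k. inverse (real (Suc k))) \<longlonglongrightarrow> 0" by (rule LIMSEQ_inverse_real_of_nat)
  qed auto
  define u where "u k = sgn (b k)" for k
  have "u k \<in> sphere 0 1" for k using b(2) by (simp add: u_def norm_sgn)
  then obtain l \<rho> where l: "l \<in> sphere 0 1" "strict_mono \<rho>" "(u \<circ> \<rho>) \<longlonglongrightarrow> l"
    using compact_sphere[of "0 :: real ^ 'n" 1] unfolding compact_def by metis
  have \<rho>_lim: "(\<lambda>k. norm (b (\<rho> k))) \<longlonglongrightarrow> 0"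
    using LIMSEQ_subseq_LIMSEQ[OF b_lim l(2)] by (simp add: o_def)
  have "torus_exp (s *\<^sub>R l) \<in> K" for s
  proof -
    \<comment> \<open>The last multiple of the short vector \<open>b (\<rho> k)\<close> before length \<open>s\<close>: it misses \<open>s\<close> by less than
      the length of \<open>b (\<rho> k)\<close>, which tends to \<open>0\<close>.\<close>
    define m where "m k = \<lfloor>s / norm (b (\<rho> k))\<rfloor>" for k
    have "(\<lambda>k. of_int (m k) * norm (b (\<rho> k)) - s) \<longlonglongrightarrow> 0"
    proof (rule Lim_null_comparison[OF always_eventually \<rho>_lim], rule allI)
      fix k
      have pos: "norm (b (\<rho> k)) > 0" using b(2) by simp
      have "of_int (m k) \<le> s / norm (b (\<rho> k))" "s / norm (b (\<rho> k)) < of_int (m k) + 1"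
        unfolding m_def by linarith+
      then have "of_int (m k) * norm (b (\<rho> k)) \<le> s" "s < (of_int (m k) + 1) * norm (b (\<rho> k))"
        using pos by (simp_all add: pos_le_divide_eq pos_divide_less_eq)
      then show "norm (of_int (m k) * norm (b (\<rho> k)) - s) \<le> norm (b (\<rho> k))"
        by (simp add: algebra_simps)
    qed
    then have "(\<lambda>k. of_int (m k) * norm (b (\<rho> k))) \<longlonglongrightarrow> s"
      by (simp add: LIM_zero_iff)
    then have "(\<lambda>k. (of_int (m k) * norm (b (\<rho> k))) *\<^sub>R u (\<rho> k)) \<longlonglongrightarrow> s *\<^sub>R l"
      using l(3) by (intro tendsto_scaleR) (simp_all add: o_def)
    moreover have "(of_int (m k) * norm (b (\<rho> k))) *\<^sub>R u (\<rho> k) = of_int (m k) *\<^sub>R b (\<rho> k)" for k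
      using b(2) by (simp add: u_def sgn_div_norm)
    ultimately have "(\<lambda>k. of_int (m k) *\<^sub>R b (\<rho> k)) \<longlonglongrightarrow> s *\<^sub>R l" by simp
    then have "(\<lambda>k. torus_exp (of_int (m k) *\<^sub>R b (\<rho> k))) \<longlonglongrightarrow> torus_exp (s *\<^sub>R l)"
      using continuous_on_tendsto_compose[OF continuous_on_torus_exp[of UNIV]] by simp
    then show ?thesis
      by (rule closed_sequentially[OF \<open>closed K\<close> torus_exp_of_int_mult_in_subgroup[OF K b(1)]])
  qed
  then have "l \<in> lie K" by (simp add: lie_def)
  moreover have "orthogonal l w" if "w \<in> lie K" for w
  proof -
    have "(\<lambda>k. u (\<rho> k) \<bullet> w) \<longlonglongrightarrow> l \<bullet> w"
      using l(3) by (intro tendsto_inner) (simp_all add: o_def)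
    moreover have "u (\<rho> k) \<bullet> w = 0" for k
      using b(4)[OF that, of "\<rho> k"] by (simp add: u_def sgn_div_norm orthogonal_def)
    ultimately show ?thesis by (simp add: orthogonal_def LIMSEQ_const_iff)
  qed
  ultimately have "orthogonal l l" by blast
  then show False using l(1) by (simp add: orthogonal_def)
qed

text \<open>The principal argument is continuous at \<open>1\<close> and vanishes there, so it is a small logarithm near \<open>1\<close>.\<close>
lemma near_one_is_torus_exp:
  fixes \<epsilon> :: real
  assumes "\<epsilon> > 0"
  obtains \<delta> where "\<delta> > 0"
    "\<And>z :: complex ^ 'n. \<lbrakk>z \<in> carrier standard_torus; dist z 1 < \<delta>\<rbrakk> \<Longrightarrow> \<exists>v. norm v < \<epsilon> \<and> torus_exp v = z"
proof -
  define L :: "complex ^ 'n \<Rightarrow> real ^ 'n" where "L z = (\<chi> i. Arg (z $ i))" for z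
  have "isCont (\<lambda>z :: complex ^ 'n. Arg (z $ i)) 1" for i
    by (rule isCont_o2[where g = Arg]) (auto intro!: continuous_intros continuous_at_Arg)
  then have "isCont L 1"
    unfolding L_def isCont_def by (intro tendsto_vec_lambda)
  moreover have "L 1 = 0" by (simp add: L_def vec_eq_iff)
  ultimately obtain \<delta> where \<delta>: "\<delta> > 0" "\<And>z. dist z 1 < \<delta> \<Longrightarrow> norm (L z) < \<epsilon>"
    using assms unfolding continuous_at_eps_delta by (metis dist_0_norm dist_commute)
  show ?thesis
  proof (rule that[OF \<delta>(1)])
    fix z :: "complex ^ 'n" assume z: "z \<in> carrier standard_torus" "dist z 1 < \<delta>"
    have "cis (Arg (z $ i)) = z $ i" for i
    proof -
      have "norm (z $ i) = 1" using z(1) by (simp add: standard_torus_def)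
      then show ?thesis using rcis_cmod_Arg[of "z $ i"] by (simp add: rcis_def)
    qed
    then have "torus_exp (L z) = z" by (simp add: torus_exp_def L_def vec_eq_iff)
    then show "\<exists>v. norm v < \<epsilon> \<and> torus_exp v = z" using \<delta>(2)[OF z(2)] by blast
  qed
qed

lemma subgroup_torus_exp_lie:
  assumes "subgroup K standard_torus"
  shows "subgroup (torus_exp ` lie K) standard_torus"
proof (rule group.subgroupI[OF group_standard_torus])
  show "torus_exp ` lie K \<noteq> {}" using subspace_0[OF subspace_lie[OF assms]] by blast
next
  fix a assume "a \<in> torus_exp ` lie K"
  then show "inv\<^bsub>standard_torus\<^esub> a \<in> torus_exp ` lie K"
    using subspace_neg[OF subspace_lie[OF assms]] by (auto simp: inv_torus_exp)
next
  fix a b assume "a \<in> torus_exp ` lie K" "b \<in> torus_exp ` lie K"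
  then obtain v w where "v \<in> lie K" "w \<in> lie K" "a = torus_exp v" "b = torus_exp w" by blast
  then show "a \<otimes>\<^bsub>standard_torus\<^esub> b \<in> torus_exp ` lie K"
    using subspace_add[OF subspace_lie[OF assms], of v w]
    by (auto simp: standard_torus_def simp flip: torus_exp_add)
qed auto

text \<open>Distances in the standard torus are translation invariant, so the statement reduces to the case \<open>z = 1\<close>,
where it combines the two preceding lemmas. The uniform \<open>\<delta>\<close> makes \<open>exp (lie K)\<close> both open and closed in
\<open>K\<close>.\<close>
lemma torus_exp_lie_uniformly_clopen:
  fixes K :: "(complex ^ 'n) set"
  assumes K: "subgroup K standard_torus" and "closed K"
  obtains \<delta> where "\<delta> > 0"
    "\<And>w z. \<lbrakk>w \<in> K; z \<in> torus_exp ` lie K; dist w z < \<delta>\<rbrakk> \<Longrightarrow> w \<in> torus_exp ` lie K"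
proof -
  obtain \<epsilon> where \<epsilon>: "\<epsilon> > 0" "\<And>v. \<lbrakk>norm v < \<epsilon>; torus_exp v \<in> K\<rbrakk> \<Longrightarrow> v \<in> lie K"
    using small_torus_exp_in_lie[OF assms] by blast
  obtain \<delta> where \<delta>: "\<delta> > 0"
    "\<And>z :: complex ^ 'n. \<lbrakk>z \<in> carrier standard_torus; dist z 1 < \<delta>\<rbrakk> \<Longrightarrow> \<exists>v. norm v < \<epsilon> \<and> torus_exp v = z"
    using near_one_is_torus_exp[OF \<epsilon>(1)] by metis
  show ?thesis
  proof (rule that[OF \<delta>(1)])
    fix w z assume w: "w \<in> K" "z \<in> torus_exp ` lie K" "dist w z < \<delta>"
    then obtain v where v: "v \<in> lie K" "z = torus_exp v" by blast
    have mv: "torus_exp (- v) \<in> K"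
      using v(1) torus_exp_lie_subset[of K] subspace_neg[OF subspace_lie[OF K]] by blast
    define y where "y = w * torus_exp (- v)"
    have "y \<in> K" unfolding y_def by (rule subgroup_mult[OF K w(1) mv])
    have yz: "w = y * torus_exp v"
      by (simp add: y_def mult.assoc flip: torus_exp_add)
    have "dist y 1 = dist w z"
    proof -
      have "w $ i - z $ i = (y $ i - 1) * cis (v $ i)" for i
        by (simp add: yz v(2) torus_exp_def algebra_simps)
      then have "norm (w $ i - z $ i) = norm (y $ i - 1)" for i
        by (simp add: norm_mult)
      then show ?thesis by (simp add: dist_vec_def dist_norm)
    qed
    then obtain v' where v': "norm v' < \<epsilon>" "torus_exp v' = y"
      using \<delta>(2)[of y] w(3) subgroup.subset[OF K] \<open>y \<in> K\<close> by auto
    then have "v' \<in> lie K" using \<epsilon>(2) \<open>y \<in> K\<close> by blast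
    then have "v' + v \<in> lie K" using v(1) subspace_add[OF subspace_lie[OF K]] by blast
    moreover have "w = torus_exp (v' + v)" by (simp add: yz v'(2) torus_exp_add)
    ultimately show "w \<in> torus_exp ` lie K" by blast
  qed
qed

text \<open>This torus is the identity component of \<open>K\<close>. It is the reason why an infinitesimal isotropy is the Lie algebra
of a subtorus, even though the isotropy group itself may be disconnected.\<close>
lemma torus_torus_exp_lie:
  assumes K: "subgroup K standard_torus" and "compact K"
  shows "torus (torus_exp ` lie K)"
proof -
  obtain \<delta> where \<delta>: "\<delta> > 0"
    "\<And>w z. \<lbrakk>w \<in> K; z \<in> torus_exp ` lie K; dist w z < \<delta>\<rbrakk> \<Longrightarrow> w \<in> torus_exp ` lie K"
    using torus_exp_lie_uniformly_clopen[OF K compact_imp_closed[OF \<open>compact K\<close>]] by metis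
  have "closed (torus_exp ` lie K)"
    unfolding closed_sequential_limits
  proof (intro allI impI, elim conjE)
    fix x l assume x: "\<forall>n. x n \<in> torus_exp ` lie K" "x \<longlonglongrightarrow> l"
    have "x n \<in> K" for n using x(1) torus_exp_lie_subset[of K] by blast
    then have "l \<in> K"
      by (rule closed_sequentially[OF compact_imp_closed[OF \<open>compact K\<close>] _ x(2)])
    obtain n where "dist (x n) l < \<delta>" using x(2) \<delta>(1) by (meson lim_sequentially order_refl)
    then have "dist l (x n) < \<delta>" by (simp add: dist_commute)
    then show "l \<in> torus_exp ` lie K" by (rule \<delta>(2)[OF \<open>l \<in> K\<close> x(1)[rule_format]])
  qed
  then have "compact (torus_exp ` lie K)"
    using compact_Int_closed[OF \<open>compact K\<close>] torus_exp_lie_subset[of K] by (metis inf.absorb_iff2)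
  moreover have "connected (torus_exp ` lie K)"
    by (intro connected_continuous_image continuous_on_torus_exp convex_connected
        subspace_imp_convex subspace_lie K)
  ultimately show ?thesis using subgroup_torus_exp_lie[OF K] by (simp add: torus_def)
qed

lemma lie_torus_exp_lie:
  assumes "subgroup K standard_torus"
  shows "lie (torus_exp ` lie K) = lie K"
proof
  show "lie (torus_exp ` lie K) \<subseteq> lie K" by (rule lie_mono[OF torus_exp_lie_subset])
  show "lie K \<subseteq> lie (torus_exp ` lie K)"
    using subspace_scale[OF subspace_lie[OF assms]] by (auto simp: lie_def[of "torus_exp ` lie K"])
qed

lemma torus_exp_lie_torus:
  assumes "torus H"
  shows "torus_exp ` lie H = H"
proof -
  have H: "subgroup H standard_torus" "compact H" "connected H"
    using assms by (auto simp: torus_def)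
  obtain \<delta> where \<delta>: "\<delta> > 0"
    "\<And>w z. \<lbrakk>w \<in> H; z \<in> torus_exp ` lie H; dist w z < \<delta>\<rbrakk> \<Longrightarrow> w \<in> torus_exp ` lie H"
    using torus_exp_lie_uniformly_clopen[OF H(1) compact_imp_closed[OF H(2)]] by metis
  have "openin (top_of_set H) (torus_exp ` lie H)"
    unfolding openin_euclidean_subtopology_iff
    using \<delta> torus_exp_lie_subset[of H] by blast
  moreover have "closedin (top_of_set H) (torus_exp ` lie H)"
    using torus_torus_exp_lie[OF H(1,2)] torus_exp_lie_subset[of H]
    by (simp add: torus_def closed_subset compact_imp_closed)
  moreover have "torus_exp ` lie H \<noteq> {}"
    using subspace_0[OF subspace_lie[OF H(1)]] by blast
  ultimately show ?thesis using H(3) by (meson connected_clopen)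
qed

section \<open>Products of algebras and their subalgebras\<close>

lemma cring_poly_algebra: "cring (poly_algebra V)"
proof (rule cringI)
  have mem: "restrict f V \<in> carrier (poly_algebra V)" if "real_polynomial_function f" for f
    using that by (auto simp: poly_algebra_def)
  have rep: "\<exists>f. real_polynomial_function f \<and> x = restrict f V" if "x \<in> carrier (poly_algebra V)" for x
    using that by (auto simp: poly_algebra_def)
  have add: "x \<oplus>\<^bsub>poly_algebra V\<^esub> y \<in> carrier (poly_algebra V)"
    if xy: "x \<in> carrier (poly_algebra V)" "y \<in> carrier (poly_algebra V)" for x y
  proof -
    obtain f g where "real_polynomial_function f" "real_polynomial_function g"
        and fg: "x = restrict f V" "y = restrict g V"
      using rep[OF xy(1)] rep[OF xy(2)] by blast
    then have "restrict (\<lambda>v. f v + g v) V \<in> carrier (poly_algebra V)"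
      by (intro mem real_polynomial_function.intros(3))
    moreover have "x \<oplus>\<^bsub>poly_algebra V\<^esub> y = restrict (\<lambda>v. f v + g v) V"
      using fg by (simp add: poly_algebra_def fun_eq_iff restrict_def)
    ultimately show ?thesis by simp
  qed
  have mult: "x \<otimes>\<^bsub>poly_algebra V\<^esub> y \<in> carrier (poly_algebra V)"
    if xy: "x \<in> carrier (poly_algebra V)" "y \<in> carrier (poly_algebra V)" for x y
  proof -
    obtain f g where "real_polynomial_function f" "real_polynomial_function g"
        and fg: "x = restrict f V" "y = restrict g V"
      using rep[OF xy(1)] rep[OF xy(2)] by blast
    then have "restrict (\<lambda>v. f v * g v) V \<in> carrier (poly_algebra V)"
      by (intro mem real_polynomial_function.intros(4))
    moreover have "x \<otimes>\<^bsub>poly_algebra V\<^esub> y = restrict (\<lambda>v. f v * g v) V"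
      using fg by (simp add: poly_algebra_def fun_eq_iff restrict_def)
    ultimately show ?thesis by simp
  qed
  have const: "(\<lambda>v\<in>V. c) \<in> carrier (poly_algebra V)" for c
    using mem[OF real_polynomial_function.intros(2)] by simp
  have ext: "x \<in> extensional V" if "x \<in> carrier (poly_algebra V)" for x
    using that by (auto simp: poly_algebra_def)
  note ops = add mult const[of 0] const[of 1]
  show "abelian_group (poly_algebra V)"
  proof (rule abelian_groupI)
    fix x assume x: "x \<in> carrier (poly_algebra V)"
    have "(\<lambda>v\<in>V. -1) \<otimes>\<^bsub>poly_algebra V\<^esub> x \<oplus>\<^bsub>poly_algebra V\<^esub> x = \<zero>\<^bsub>poly_algebra V\<^esub>"
      using ext[OF x] by (auto simp: poly_algebra_def fun_eq_iff restrict_def extensional_def)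
    then show "\<exists>y\<in>carrier (poly_algebra V). y \<oplus>\<^bsub>poly_algebra V\<^esub> x = \<zero>\<^bsub>poly_algebra V\<^esub>"
      using mult[OF const x] by blast
  qed (use ops in \<open>auto simp: poly_algebra_def intro!: restrict_ext\<close>)
  show "comm_monoid (poly_algebra V)"
    by (rule comm_monoidI) (use ops in \<open>auto simp: poly_algebra_def intro!: restrict_ext\<close>)
  show "(x \<oplus>\<^bsub>poly_algebra V\<^esub> y) \<otimes>\<^bsub>poly_algebra V\<^esub> z =
      x \<otimes>\<^bsub>poly_algebra V\<^esub> z \<oplus>\<^bsub>poly_algebra V\<^esub> y \<otimes>\<^bsub>poly_algebra V\<^esub> z" for x y z
    by (auto simp: poly_algebra_def algebra_simps intro!: restrict_ext)
qed

lemma restrict_ring_hom_poly_algebra: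
  fixes V W :: "(real ^ 'n) set"
  assumes "W \<subseteq> V"
  shows "(\<lambda>f. restrict f W) \<in> ring_hom (poly_algebra V) (poly_algebra W)"
proof (rule ring_hom_memI)
  fix x assume "x \<in> carrier (poly_algebra V)"
  moreover have "restrict (restrict f V) W = restrict f W" for f :: "real ^ 'n \<Rightarrow> real"
    using assms by (simp add: Int_absorb1)
  ultimately show "restrict x W \<in> carrier (poly_algebra W)"
    by (auto simp: poly_algebra_def)
qed (use assms in \<open>auto simp: poly_algebra_def fun_eq_iff restrict_def\<close>)

text \<open>The common shape of the two algebras of the theorem: the scalar ring acts on the factor \<open>R i\<close> through the ring
homomorphism \<open>\<rho> i\<close>. For a power of the scalar ring these homomorphisms are the identity; for assignments they
are restrictions of polynomials to the infinitesimal isotropies, and the assignments form a subalgebra.\<close>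
definition product_algebra :: "'i set \<Rightarrow> ('i \<Rightarrow> 'a ring) \<Rightarrow> ('i \<Rightarrow> 's \<Rightarrow> 'a) \<Rightarrow> ('s, 'i \<Rightarrow> 'a) module" where
  "product_algebra I R \<rho> =
     \<lparr>carrier = (\<Pi>\<^sub>E i \<in> I. carrier (R i)),
      monoid.mult = (\<lambda>f g. \<lambda>i\<in>I. f i \<otimes>\<^bsub>R i\<^esub> g i),
      one = (\<lambda>i\<in>I. \<one>\<^bsub>R i\<^esub>),
      zero = (\<lambda>i\<in>I. \<zero>\<^bsub>R i\<^esub>),
      add = (\<lambda>f g. \<lambda>i\<in>I. f i \<oplus>\<^bsub>R i\<^esub> g i),
      smult = (\<lambda>a f. \<lambda>i\<in>I. \<rho> i a \<otimes>\<^bsub>R i\<^esub> f i)\<rparr>"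

lemma algebra_product_algebra:
  assumes S: "cring S"
    and R: "\<And>i. i \<in> I \<Longrightarrow> cring (R i)"
    and \<rho>: "\<And>i. i \<in> I \<Longrightarrow> \<rho> i \<in> ring_hom S (R i)"
  shows "Module.algebra S (product_algebra I R \<rho>)"
proof -
  let ?P = "product_algebra I R \<rho>"
  have at: "(x \<oplus>\<^bsub>?P\<^esub> y) i = x i \<oplus>\<^bsub>R i\<^esub> y i" "(x \<otimes>\<^bsub>?P\<^esub> y) i = x i \<otimes>\<^bsub>R i\<^esub> y i"
      "\<zero>\<^bsub>?P\<^esub> i = \<zero>\<^bsub>R i\<^esub>" "\<one>\<^bsub>?P\<^esub> i = \<one>\<^bsub>R i\<^esub>" "(a \<odot>\<^bsub>?P\<^esub> x) i = \<rho> i a \<otimes>\<^bsub>R i\<^esub> x i"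
    if "i \<in> I" for x y a i
    using that by (simp_all add: product_algebra_def)
  have mem: "x i \<in> carrier (R i)" if "x \<in> carrier ?P" "i \<in> I" for x i
    using that by (auto simp: product_algebra_def)
  have eqI: "x = y" if "x \<in> carrier ?P" "y \<in> carrier ?P" "\<And>i. i \<in> I \<Longrightarrow> x i = y i" for x y
    using that by (auto simp: product_algebra_def intro: PiE_ext)
  note R_ring = cring.axioms(1)[OF R]
  note hom = ring_hom_closed[OF \<rho>] ring_hom_mult[OF \<rho>] ring_hom_add[OF \<rho>] ring_hom_one[OF \<rho>]
  have closed: "x \<oplus>\<^bsub>?P\<^esub> y \<in> carrier ?P" "x \<otimes>\<^bsub>?P\<^esub> y \<in> carrier ?P"
    if "x \<in> carrier ?P" "y \<in> carrier ?P" for x y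
    using that by (auto simp: product_algebra_def PiE_iff ring.ring_simprules[OF R_ring])
  have const: "\<zero>\<^bsub>?P\<^esub> \<in> carrier ?P" "\<one>\<^bsub>?P\<^esub> \<in> carrier ?P"
    by (auto simp: product_algebra_def ring.ring_simprules[OF R_ring])
  have smult: "a \<odot>\<^bsub>?P\<^esub> x \<in> carrier ?P" if "a \<in> carrier S" "x \<in> carrier ?P" for a x
    using that by (auto simp: product_algebra_def PiE_iff ring.ring_simprules[OF R_ring] hom)
  note facts = closed const smult at mem
  have ab: "abelian_group ?P"
  proof (rule abelian_groupI)
    fix x y z assume xyz: "x \<in> carrier ?P" "y \<in> carrier ?P" "z \<in> carrier ?P"
    show "x \<oplus>\<^bsub>?P\<^esub> y \<oplus>\<^bsub>?P\<^esub> z = x \<oplus>\<^bsub>?P\<^esub> (y \<oplus>\<^bsub>?P\<^esub> z)"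
      by (rule eqI) (simp_all add: facts xyz ring.ring_simprules(7)[OF R_ring])
  next
    fix x y assume xy: "x \<in> carrier ?P" "y \<in> carrier ?P"
    show "x \<oplus>\<^bsub>?P\<^esub> y = y \<oplus>\<^bsub>?P\<^esub> x"
      by (rule eqI) (simp_all add: facts xy ring.ring_simprules(10)[OF R_ring])
  next
    fix x assume x: "x \<in> carrier ?P"
    show "\<zero>\<^bsub>?P\<^esub> \<oplus>\<^bsub>?P\<^esub> x = x"
      by (rule eqI) (simp_all add: facts x ring.ring_simprules(8)[OF R_ring])
    let ?y = "\<lambda>i\<in>I. \<ominus>\<^bsub>R i\<^esub> x i"
    have y: "?y \<in> carrier ?P"
      using x by (auto simp: product_algebra_def PiE_iff ring.ring_simprules[OF R_ring])
    have "?y \<oplus>\<^bsub>?P\<^esub> x = \<zero>\<^bsub>?P\<^esub>"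
      by (rule eqI) (simp_all add: facts x y ring.ring_simprules(9)[OF R_ring])
    then show "\<exists>y\<in>carrier ?P. y \<oplus>\<^bsub>?P\<^esub> x = \<zero>\<^bsub>?P\<^esub>" using y by blast
  qed (use facts in auto)
  have cr: "cring ?P"
  proof (rule cringI[OF ab comm_monoidI])
    fix x y z assume xyz: "x \<in> carrier ?P" "y \<in> carrier ?P" "z \<in> carrier ?P"
    show "x \<otimes>\<^bsub>?P\<^esub> y \<otimes>\<^bsub>?P\<^esub> z = x \<otimes>\<^bsub>?P\<^esub> (y \<otimes>\<^bsub>?P\<^esub> z)"
      by (rule eqI) (simp_all add: facts xyz ring.ring_simprules(11)[OF R_ring])
    show "(x \<oplus>\<^bsub>?P\<^esub> y) \<otimes>\<^bsub>?P\<^esub> z = x \<otimes>\<^bsub>?P\<^esub> z \<oplus>\<^bsub>?P\<^esub> y \<otimes>\<^bsub>?P\<^esub> z"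
      by (rule eqI) (simp_all add: facts xyz ring.ring_simprules(13)[OF R_ring])
  next
    fix x y assume xy: "x \<in> carrier ?P" "y \<in> carrier ?P"
    show "x \<otimes>\<^bsub>?P\<^esub> y = y \<otimes>\<^bsub>?P\<^esub> x"
      by (rule eqI) (simp_all add: facts xy comm_monoid.m_comm[OF cring.axioms(2)[OF R]])
  next
    fix x assume x: "x \<in> carrier ?P"
    show "\<one>\<^bsub>?P\<^esub> \<otimes>\<^bsub>?P\<^esub> x = x"
      by (rule eqI) (simp_all add: facts x ring.ring_simprules(12)[OF R_ring])
  qed (use facts in auto)
  show ?thesis
  proof (rule algebraI[OF S cr])
    fix a b x assume abx: "a \<in> carrier S" "b \<in> carrier S" "x \<in> carrier ?P"
    note S_closed = ring.ring_simprules[OF cring.axioms(1)[OF S]]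
    show "(a \<oplus>\<^bsub>S\<^esub> b) \<odot>\<^bsub>?P\<^esub> x = a \<odot>\<^bsub>?P\<^esub> x \<oplus>\<^bsub>?P\<^esub> b \<odot>\<^bsub>?P\<^esub> x"
      by (rule eqI) (simp_all add: facts abx hom S_closed ring.ring_simprules(13)[OF R_ring])
    show "(a \<otimes>\<^bsub>S\<^esub> b) \<odot>\<^bsub>?P\<^esub> x = a \<odot>\<^bsub>?P\<^esub> (b \<odot>\<^bsub>?P\<^esub> x)"
      by (rule eqI) (simp_all add: facts abx hom S_closed ring.ring_simprules(11)[OF R_ring])
  next
    fix a x y assume axy: "a \<in> carrier S" "x \<in> carrier ?P" "y \<in> carrier ?P"
    show "a \<odot>\<^bsub>?P\<^esub> (x \<oplus>\<^bsub>?P\<^esub> y) = a \<odot>\<^bsub>?P\<^esub> x \<oplus>\<^bsub>?P\<^esub> a \<odot>\<^bsub>?P\<^esub> y"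
      by (rule eqI) (simp_all add: facts axy hom ring.ring_simprules(23)[OF R_ring])
    show "(a \<odot>\<^bsub>?P\<^esub> x) \<otimes>\<^bsub>?P\<^esub> y = a \<odot>\<^bsub>?P\<^esub> (x \<otimes>\<^bsub>?P\<^esub> y)"
      by (rule eqI) (simp_all add: facts axy hom ring.ring_simprules(11)[OF R_ring])
  next
    fix x assume x: "x \<in> carrier ?P"
    have "\<one>\<^bsub>S\<^esub> \<in> carrier S" using S by (simp add: ring.ring_simprules cring.axioms)
    then show "\<one>\<^bsub>S\<^esub> \<odot>\<^bsub>?P\<^esub> x = x"
      by (intro eqI) (simp_all add: facts x hom ring.ring_simprules(12)[OF R_ring])
  qed (use facts in auto)
qed

text \<open>Closure under negation comes from closure under scalars, as the negative is multiplication by \<open>\<ominus>\<one>\<close>.\<close>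
lemma subalgebra_ofI:
  assumes M: "Module.algebra R M"
    and A: "A \<subseteq> carrier M" "\<one>\<^bsub>M\<^esub> \<in> A"
    and add: "\<And>x y. \<lbrakk>x \<in> A; y \<in> A\<rbrakk> \<Longrightarrow> x \<oplus>\<^bsub>M\<^esub> y \<in> A"
    and mult: "\<And>x y. \<lbrakk>x \<in> A; y \<in> A\<rbrakk> \<Longrightarrow> x \<otimes>\<^bsub>M\<^esub> y \<in> A"
    and smult: "\<And>a x. \<lbrakk>a \<in> carrier R; x \<in> A\<rbrakk> \<Longrightarrow> a \<odot>\<^bsub>M\<^esub> x \<in> A"
  shows "subalgebra_of R A M"
proof -
  interpret Module.algebra R M by (rule M)
  have "\<ominus>\<^bsub>M\<^esub> x \<in> A" if "x \<in> A" for x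
    using smult[of "\<ominus>\<^bsub>R\<^esub> \<one>\<^bsub>R\<^esub>" x] that A(1) smult_l_minus[of "\<one>\<^bsub>R\<^esub>" x] by auto
  then have "subring A M"
    using A add mult by (intro ring.subringI[OF cring.axioms(1)[OF M_cring]])
  then show ?thesis using smult by (auto simp: subalgebra_of_def)
qed

lemma algebra_of_subalgebra:
  assumes "Module.algebra R M" and "subalgebra_of R A M"
  shows "Module.algebra R (M\<lparr>carrier := A\<rparr>)"
proof -
  interpret Module.algebra R M by (rule assms)
  have "subring A M" using assms(2) by (simp add: subalgebra_of_def)
  then have A: "A \<subseteq> carrier M" and "subcring A M"
    using subringE(1) cring.subcringI'[OF M_cring] by auto
  have cr: "cring (M\<lparr>carrier := A\<rparr>)"
    using \<open>subcring A M\<close> ring.subcring_iff[OF cring.axioms(1)[OF M_cring] A] by blast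
  note mem = subsetD[OF A]
  show ?thesis
  proof (rule algebraI[OF R_cring cr])
    show "a \<odot>\<^bsub>M\<lparr>carrier := A\<rparr>\<^esub> x \<in> carrier (M\<lparr>carrier := A\<rparr>)"
      if "a \<in> carrier R" "x \<in> carrier (M\<lparr>carrier := A\<rparr>)" for a x
      using assms(2) that by (simp add: subalgebra_of_def)
  qed (simp_all add: mem smult_l_distr smult_r_distr smult_assoc1 smult_assoc2)
qed

section \<open>Locally constant functions and closed covers\<close>

lemma locally_constant_on_connectedin:
  assumes f: "locally_constant_on Y f" and C: "connectedin Y C" and pq: "p \<in> C" "q \<in> C"
  shows "f p = f q"
proof (rule ccontr)
  assume ne: "f p \<noteq> f q"
  have open_level: "openin Y {x \<in> topspace Y. P (f x)}" for P
  proof (subst openin_subopen, clarify)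
    fix x assume x: "x \<in> topspace Y" "P (f x)"
    then obtain U where U: "openin Y U" "x \<in> U" "\<forall>y\<in>U. f y = f x"
      using f unfolding locally_constant_on_def by blast
    have "U \<subseteq> {x \<in> topspace Y. P (f x)}"
    proof
      fix y assume "y \<in> U"
      then have "f y = f x" "y \<in> topspace Y" using U(3) openin_subset[OF U(1)] by blast+
      then show "y \<in> {x \<in> topspace Y. P (f x)}" using x(2) by simp
    qed
    then show "\<exists>U. openin Y U \<and> x \<in> U \<and> U \<subseteq> {x \<in> topspace Y. P (f x)}"
      using U by blast
  qed
  let ?E = "{x \<in> topspace Y. f x = f p}" and ?N = "{x \<in> topspace Y. f x \<noteq> f p}"
  have "C \<subseteq> topspace Y" using C by (rule connectedin_subset_topspace)
  then have "C \<subseteq> ?E \<union> ?N" "?E \<inter> ?N \<inter> C = {}" "p \<in> ?E \<inter> C" "q \<in> ?N \<inter> C"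
    using ne pq by auto
  then show False
    using C open_level[of "\<lambda>c. c = f p"] open_level[of "\<lambda>c. c \<noteq> f p"]
    unfolding connectedin by blast
qed

text \<open>Components are open once there are finitely many of them.\<close>
lemma locally_constant_on_finite_components:
  assumes "finite (connected_components_of Y)"
    and "\<And>C p q. \<lbrakk>C \<in> connected_components_of Y; p \<in> C; q \<in> C\<rbrakk> \<Longrightarrow> f p = f q"
  shows "locally_constant_on Y f"
  unfolding locally_constant_on_def
proof
  fix p assume p: "p \<in> topspace Y"
  then obtain C where C: "C \<in> connected_components_of Y" "p \<in> C"
    using Union_connected_components_of[of Y] by blast
  then have "openin Y C" using open_in_finite_connected_components[OF assms(1)] by blast
  then show "\<exists>U. openin Y U \<and> p \<in> U \<and> (\<forall>q\<in>U. f q = f p)"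
    using C assms(2) by blast
qed

text \<open>Any pointwise construction from locally constant functions is locally constant. The hypothesis is phrased by
values, so that \<open>h\<close> need only depend on \<open>f\<close> and \<open>g\<close> at points of the space.\<close>
lemma locally_constant_on_combine:
  assumes f: "locally_constant_on Y f" and g: "locally_constant_on Y g"
    and h: "\<And>p q. \<lbrakk>p \<in> topspace Y; q \<in> topspace Y; f p = f q; g p = g q\<rbrakk> \<Longrightarrow> h p = h q"
  shows "locally_constant_on Y h"
  unfolding locally_constant_on_def
proof
  fix p assume p: "p \<in> topspace Y"
  then obtain U V where "openin Y U" "p \<in> U" "\<forall>q\<in>U. f q = f p" "openin Y V" "p \<in> V" "\<forall>q\<in>V. g q = g p"
    using f g unfolding locally_constant_on_def by meson
  then show "\<exists>W. openin Y W \<and> p \<in> W \<and> (\<forall>q\<in>W. h q = h p)"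
    using p openin_subset[of Y U] by (intro exI[of _ "U \<inter> V"]) (blast intro!: h openin_Int)
qed

lemma locally_constant_on_const: "(\<And>p q. \<lbrakk>p \<in> topspace Y; q \<in> topspace Y\<rbrakk> \<Longrightarrow> f p = f q) \<Longrightarrow> locally_constant_on Y f"
  unfolding locally_constant_on_def by (metis openin_subset openin_topspace)

lemma locally_constant_on_subtopology:
  assumes "locally_constant_on Y f"
  shows "locally_constant_on (subtopology Y S) f"
  unfolding locally_constant_on_def
proof
  fix p assume "p \<in> topspace (subtopology Y S)"
  then obtain U where "openin Y U" "p \<in> U" "\<forall>q\<in>U. f q = f p" "p \<in> S"
    using assms unfolding locally_constant_on_def by auto
  then show "\<exists>U. openin (subtopology Y S) U \<and> p \<in> U \<and> (\<forall>q\<in>U. f q = f p)"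
    using openin_subtopology_Int[of Y U S] by (intro exI[of _ "U \<inter> S"]) blast
qed

text \<open>The members of the cover on which \<open>F\<close> takes the value \<open>F p\<close>, and the others, have closed unions that split \<open>S\<close>.
The members of the cover need not be contained in \<open>S\<close>.\<close>
lemma connectedin_finite_closed_cover_constant:
  assumes S: "connectedin X S"
    and \<D>: "finite \<D>" "\<And>D. D \<in> \<D> \<Longrightarrow> closedin X D" "S \<subseteq> \<Union>\<D>"
    and F: "\<And>D p q. \<lbrakk>D \<in> \<D>; p \<in> D \<inter> S; q \<in> D \<inter> S\<rbrakk> \<Longrightarrow> F p = F q"
    and pq: "p \<in> S" "q \<in> S"
  shows "F p = F q"
proof (rule ccontr)
  assume ne: "F p \<noteq> F q"
  define K where "K = \<Union>{D \<in> \<D>. \<exists>x \<in> D \<inter> S. F x = F p}"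
  define L where "L = \<Union>{D \<in> \<D>. \<exists>x \<in> D \<inter> S. F x \<noteq> F p}"
  have K: "F x = F p" if x: "x \<in> K \<inter> S" for x
  proof -
    obtain D y where "D \<in> \<D>" "y \<in> D \<inter> S" "F y = F p" "x \<in> D" using x unfolding K_def by blast
    then show ?thesis using F[of D x y] x by simp
  qed
  have L: "F x \<noteq> F p" if x: "x \<in> L \<inter> S" for x
  proof -
    obtain D y where "D \<in> \<D>" "y \<in> D \<inter> S" "F y \<noteq> F p" "x \<in> D" using x unfolding L_def by blast
    then show ?thesis using F[of D x y] x by simp
  qed
  have cover: "x \<in> K \<or> x \<in> L" if x: "x \<in> S" for x
  proof -
    obtain D where "D \<in> \<D>" "x \<in> D" using x \<D>(3) by blast
    then show ?thesis using x unfolding K_def L_def by (cases "F x = F p") blast+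
  qed
  have "closedin X K" "closedin X L"
    unfolding K_def L_def by (rule closedin_Union; use \<D>(1,2) in simp)+
  moreover have "S \<subseteq> K \<union> L" "K \<inter> L \<inter> S = {}" using cover K L by auto
  moreover have "p \<in> K \<inter> S" "q \<in> L \<inter> S" using cover[OF pq(1)] cover[OF pq(2)] K[of q] L[of p] pq ne by auto
  ultimately show False using S unfolding connectedin_closedin by blast
qed

section \<open>The algebra of assignments\<close>

lemma restrict_binop_cong:
  assumes "restrict f V = restrict f' V" "restrict g V = restrict g' V"
  shows "(\<lambda>v\<in>V. op (f v) (g v)) = (\<lambda>v\<in>V. op (f' v) (g' v))"
proof (rule restrict_ext)
  fix v assume "v \<in> V"
  then have "f v = f' v" "g v = g' v" using assms by (metis restrict_apply')+
  then show "op (f v) (g v) = op (f' v) (g' v)" by simp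
qed

lemma lie_subset_inf_isotropy:
  "p \<in> fixed_points T Y \<phi> H \<Longrightarrow> lie H \<subseteq> inf_isotropy T \<phi> p"
  by (auto simp: fixed_points_def inf_isotropy_def intro!: lie_mono)

lemma inf_isotropy_subset_lie: "inf_isotropy T \<phi> p \<subseteq> lie T"
  unfolding inf_isotropy_def by (rule lie_mono) (auto simp: stabilizer_def)

lemma assignment_algebra_eq_product:
  "assignment_algebra T Y \<phi> =
     product_algebra (topspace Y) (\<lambda>p. poly_algebra (inf_isotropy T \<phi> p))
       (\<lambda>p f. restrict f (inf_isotropy T \<phi> p))\<lparr>carrier := assignments T Y \<phi>\<rparr>"
  by (simp add: assignment_algebra_def product_algebra_def)

lemma power_algebra_eq_product: "power_algebra J R = product_algebra J (\<lambda>_. R) (\<lambda>_ a. a)"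
  by (simp add: power_algebra_def product_algebra_def)

lemma algebra_power_algebra:
  assumes "cring R"
  shows "Module.algebra R (power_algebra J R)"
  unfolding power_algebra_eq_product
  by (rule algebra_product_algebra) (use assms in \<open>auto simp: ring_hom_def\<close>)

lemma assignments_mem:
  "A \<in> assignments T Y \<phi> \<Longrightarrow> p \<in> topspace Y \<Longrightarrow> A p \<in> carrier (poly_algebra (inf_isotropy T \<phi> p))"
  by (auto simp: assignments_def)

lemma assignments_locally_constant:
  "\<lbrakk>A \<in> assignments T Y \<phi>; torus H; H \<subseteq> T\<rbrakk> \<Longrightarrow>
    locally_constant_on (subtopology Y (fixed_points T Y \<phi> H)) (\<lambda>p. restrict (A p) (lie H))"
  by (auto simp: assignments_def)

text \<open>Assignments are closed under the pointwise operations because \<open>lie H\<close> lies in the infinitesimal isotropy of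
every point fixed by \<open>H\<close>: the restriction to \<open>lie H\<close> of a sum or product is the sum or product of the
restrictions.\<close>
lemma algebra_assignment_algebra:
  "Module.algebra (poly_algebra (lie T)) (assignment_algebra T Y \<phi>)"
proof -
  let ?P = "product_algebra (topspace Y) (\<lambda>p. poly_algebra (inf_isotropy T \<phi> p))
       (\<lambda>p f. restrict f (inf_isotropy T \<phi> p))"
  have P: "Module.algebra (poly_algebra (lie T)) ?P"
    by (intro algebra_product_algebra cring_poly_algebra restrict_ring_hom_poly_algebra
        inf_isotropy_subset_lie)
  interpret P: Module.algebra "poly_algebra (lie T)" ?P by (rule P)
  have carr: "A \<in> carrier ?P" if "A \<in> assignments T Y \<phi>" for A
    using that by (simp add: assignments_def product_algebra_def)
  have memI: "A \<in> assignments T Y \<phi>"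
    if "A \<in> carrier ?P" "\<And>H. \<lbrakk>torus H; H \<subseteq> T\<rbrakk> \<Longrightarrow>
      locally_constant_on (subtopology Y (fixed_points T Y \<phi> H)) (\<lambda>p. restrict (A p) (lie H))" for A
    using that by (simp add: assignments_def product_algebra_def)
  have restrict_add: "restrict ((A \<oplus>\<^bsub>?P\<^esub> B) p) (lie H) = (\<lambda>v\<in>lie H. A p v + B p v)"
    and restrict_mult: "restrict ((A \<otimes>\<^bsub>?P\<^esub> B) p) (lie H) = (\<lambda>v\<in>lie H. A p v * B p v)"
    and restrict_smult: "restrict ((a \<odot>\<^bsub>?P\<^esub> B) p) (lie H) = (\<lambda>v\<in>lie H. a v * B p v)"
    and restrict_one: "restrict (\<one>\<^bsub>?P\<^esub> p) (lie H) = (\<lambda>v\<in>lie H. 1)"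
    if "p \<in> topspace (subtopology Y (fixed_points T Y \<phi> H))" for A B a p H
    using that lie_subset_inf_isotropy[of p T Y \<phi> H]
    by (auto simp: product_algebra_def poly_algebra_def fixed_points_def fun_eq_iff restrict_def subset_iff)
  have "subalgebra_of (poly_algebra (lie T)) (assignments T Y \<phi>) ?P"
  proof (rule subalgebra_ofI[OF P])
    show "\<one>\<^bsub>?P\<^esub> \<in> assignments T Y \<phi>"
      by (rule memI) (auto intro!: locally_constant_on_const simp: restrict_one)
    show "A \<oplus>\<^bsub>?P\<^esub> B \<in> assignments T Y \<phi>" if A: "A \<in> assignments T Y \<phi>" and B: "B \<in> assignments T Y \<phi>" for A B
    proof (rule memI)
      fix H assume H: "torus H" "H \<subseteq> T"
      show "locally_constant_on (subtopology Y (fixed_points T Y \<phi> H)) (\<lambda>p. restrict ((A \<oplus>\<^bsub>?P\<^esub> B) p) (lie H))"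
        by (rule locally_constant_on_combine[OF assignments_locally_constant[OF A H]
              assignments_locally_constant[OF B H]])
          (simp only: restrict_add, rule restrict_binop_cong[where f = "A _" and g = "B _" and op = "(+)"])
    qed (use carr A B in auto)
    show "A \<otimes>\<^bsub>?P\<^esub> B \<in> assignments T Y \<phi>" if A: "A \<in> assignments T Y \<phi>" and B: "B \<in> assignments T Y \<phi>" for A B
    proof (rule memI)
      fix H assume H: "torus H" "H \<subseteq> T"
      show "locally_constant_on (subtopology Y (fixed_points T Y \<phi> H)) (\<lambda>p. restrict ((A \<otimes>\<^bsub>?P\<^esub> B) p) (lie H))"
        by (rule locally_constant_on_combine[OF assignments_locally_constant[OF A H]
              assignments_locally_constant[OF B H]])
          (simp only: restrict_mult, rule restrict_binop_cong[where f = "A _" and g = "B _" and op = "(*)"])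
    qed (use carr A B in auto)
    show "a \<odot>\<^bsub>?P\<^esub> A \<in> assignments T Y \<phi>" if a: "a \<in> carrier (poly_algebra (lie T))" and A: "A \<in> assignments T Y \<phi>" for a A
    proof (rule memI)
      fix H assume H: "torus H" "H \<subseteq> T"
      show "locally_constant_on (subtopology Y (fixed_points T Y \<phi> H)) (\<lambda>p. restrict ((a \<odot>\<^bsub>?P\<^esub> A) p) (lie H))"
        by (rule locally_constant_on_combine[OF assignments_locally_constant[OF A H]
              assignments_locally_constant[OF A H]])
          (simp only: restrict_smult, rule restrict_binop_cong[where f = a and g = "A _" and op = "(*)"], rule refl)
    qed (use carr A a in auto)
  qed (use carr in auto)
  then show ?thesis
    unfolding assignment_algebra_eq_product by (rule algebra_of_subalgebra[OF P])
qed

section \<open>Infinitesimal isotropies and fixed point sets\<close>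

locale torus_space =
  fixes T :: "(complex ^ 'n) set" and X :: "'x topology" and \<phi> :: "complex ^ 'n \<Rightarrow> 'x \<Rightarrow> 'x"
  assumes torus_T: "torus T" and Hausdorff: "Hausdorff_space X"
    and action: "continuous_torus_action T X \<phi>"
begin

abbreviation Fix :: "(complex ^ 'n) set \<Rightarrow> 'x set" where "Fix \<equiv> fixed_points T X \<phi>"

abbreviation \<tt> :: "'x \<Rightarrow> (real ^ 'n) set" where "\<tt> \<equiv> inf_isotropy T \<phi>"

abbreviation components :: "(complex ^ 'n) set \<Rightarrow> 'x set set" where
  "components H \<equiv> connected_components_of (subtopology X (Fix H))"

lemma group_action: "group_action (torus_group T) (topspace X) \<phi>"
  using action by (simp add: continuous_torus_action_def)

lemma isotropy_subset: "isotropy T \<phi> p \<subseteq> T"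
  by (auto simp: stabilizer_def)

lemma subgroup_isotropy:
  assumes "p \<in> topspace X"
  shows "subgroup (isotropy T \<phi> p) standard_torus"
  using group.incl_subgroup[OF group_standard_torus _ group_action.stabilizer_subgroup[OF group_action assms]]
    torus_T by (simp add: torus_def)

lemma continuous_orbit_map:
  assumes "p \<in> topspace X"
  shows "continuous_map (top_of_set T) X (\<lambda>g. \<phi> g p)"
proof -
  have "continuous_map (top_of_set T) (prod_topology (top_of_set T) X) (\<lambda>g. (g, p))"
    using assms by (intro continuous_map_pairedI) auto
  then show ?thesis
    using action continuous_map_compose unfolding continuous_torus_action_def o_def by fastforce
qed

lemma compact_isotropy:
  assumes "p \<in> topspace X"
  shows "compact (isotropy T \<phi> p)"
proof -
  have "closedin (top_of_set T) {g \<in> topspace (top_of_set T). \<phi> g p = p}"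
    by (rule closedin_continuous_maps_eq[OF Hausdorff continuous_orbit_map[OF assms]])
      (simp add: assms)
  moreover have "isotropy T \<phi> p = {g \<in> topspace (top_of_set T). \<phi> g p = p}"
    by (auto simp: stabilizer_def)
  ultimately show ?thesis
    using torus_T closedin_compact[of T "isotropy T \<phi> p"] by (simp add: torus_def)
qed

lemma subspace_inf_isotropy: "p \<in> topspace X \<Longrightarrow> subspace (\<tt> p)"
  unfolding inf_isotropy_def by (intro subspace_lie subgroup_isotropy)

text \<open>The identity component of the isotropy group, the subtorus with Lie algebra \<open>\<tt> p\<close>.\<close>
definition iso_torus :: "'x \<Rightarrow> (complex ^ 'n) set" where "iso_torus p = torus_exp ` \<tt> p"

lemma iso_torus:
  assumes "p \<in> topspace X"
  shows "torus (iso_torus p)" "iso_torus p \<subseteq> T" "lie (iso_torus p) = \<tt> p" "p \<in> Fix (iso_torus p)"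
proof -
  show "torus (iso_torus p)" "lie (iso_torus p) = \<tt> p"
    unfolding iso_torus_def inf_isotropy_def
    by (simp_all add: torus_torus_exp_lie lie_torus_exp_lie subgroup_isotropy compact_isotropy assms)
  have sub: "iso_torus p \<subseteq> isotropy T \<phi> p"
    unfolding iso_torus_def inf_isotropy_def by (rule torus_exp_lie_subset)
  then show "iso_torus p \<subseteq> T" using isotropy_subset by blast
  show "p \<in> Fix (iso_torus p)" using sub assms by (simp add: fixed_points_def)
qed

text \<open>A torus is the image of its Lie algebra under the exponential map, so whether it fixes a point can be read off
infinitesimally.\<close>
lemma fixed_points_torus:
  assumes "torus H"
  shows "Fix H = {p \<in> topspace X. lie H \<subseteq> \<tt> p}"
proof -
  have "H \<subseteq> isotropy T \<phi> p" if "lie H \<subseteq> \<tt> p" for p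
    using that torus_exp_lie_subset[of "isotropy T \<phi> p"] torus_exp_lie_torus[OF assms]
    unfolding inf_isotropy_def by blast
  then show ?thesis
    using lie_mono[of H] by (auto simp: fixed_points_def inf_isotropy_def)
qed

lemma inf_fixed_points_eq: "p \<in> topspace X \<Longrightarrow> inf_fixed_points T X \<phi> (\<tt> p) = Fix (iso_torus p)"
  by (simp add: fixed_points_torus iso_torus inf_fixed_points_def)

lemma fixed_points_antimono: "H \<subseteq> K \<Longrightarrow> Fix K \<subseteq> Fix H"
  by (auto simp: fixed_points_def)

lemma fixed_points_subset: "Fix H \<subseteq> topspace X"
  by (auto simp: fixed_points_def)

lemma fixed_iff: "p \<in> Fix T \<longleftrightarrow> p \<in> topspace X \<and> \<tt> p = lie T"
  using inf_isotropy_subset_lie[of T \<phi> p] by (auto simp: fixed_points_torus[OF torus_T])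

lemma iso_torus_fixed: "p \<in> Fix T \<Longrightarrow> iso_torus p = T"
  by (simp add: iso_torus_def fixed_iff torus_exp_lie_torus torus_T)

lemma closedin_fixed_points:
  assumes "H \<subseteq> T"
  shows "closedin X (Fix H)"
proof -
  have "closedin X {p \<in> topspace X. \<phi> g p = p}" if "g \<in> H" for g
  proof -
    have "continuous_map X (prod_topology (top_of_set T) X) (\<lambda>p. (g, p))"
      using that assms by (intro continuous_map_pairedI) auto
    then have "continuous_map X X (\<lambda>p. \<phi> g p)"
      using action continuous_map_compose unfolding continuous_torus_action_def o_def by fastforce
    then show ?thesis
      by (intro closedin_continuous_maps_eq[OF Hausdorff]) auto
  qed
  then have "closedin X (topspace X \<inter> (\<Inter>g\<in>H. {p \<in> topspace X. \<phi> g p = p}))"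
    by (cases "H = {}") (auto intro!: closedin_Inter closedin_Int)
  moreover have "Fix H = topspace X \<inter> (\<Inter>g\<in>H. {p \<in> topspace X. \<phi> g p = p})"
    using assms by (auto simp: fixed_points_def stabilizer_def)
  ultimately show ?thesis by simp
qed

lemma closedin_component:
  assumes "H \<subseteq> T" "C \<in> components H"
  shows "closedin X C"
  using closedin_connected_components_of[OF assms(2)] closedin_fixed_points[OF assms(1)]
  by (rule closedin_trans_full)

lemma skeleton_codim:
  assumes p: "p \<in> one_skeleton T X \<phi>" and "p \<notin> Fix T"
  shows "codim_in T (\<tt> p) = 1"
proof -
  have p': "p \<in> topspace X" using p by (simp add: one_skeleton_def)
  have "\<tt> p \<noteq> lie T" using \<open>p \<notin> Fix T\<close> p' by (simp add: fixed_iff)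
  then have "dim (\<tt> p) \<noteq> dim (lie T)" "dim (\<tt> p) \<le> dim (lie T)"
    using inf_isotropy_subset_lie[of T \<phi> p] subspace_inf_isotropy[OF p'] torus_T subspace_lie[of T]
      subspace_dim_equal[of "\<tt> p" "lie T"] dim_subset[of "\<tt> p" "lie T"]
    unfolding torus_def by fastforce+
  moreover have "dim (lie T) - dim (\<tt> p) \<le> 1" using p by (simp add: codim_in_def one_skeleton_def)
  ultimately show ?thesis unfolding codim_in_def by linarith
qed

text \<open>On the one-skeleton, a point outside the fixed point set of \<open>T\<close> has an isotropy of codimension exactly one,
which leaves no room for a strict inclusion between two of them.\<close>
lemma codim_one_skeleton:
  assumes p: "p \<in> one_skeleton T X \<phi>" "p \<notin> Fix T"
    and q: "q \<in> topspace X" "codim_in T (\<tt> q) = 1" "\<tt> q \<subseteq> \<tt> p"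
  shows "\<tt> p = \<tt> q"
proof -
  have p': "p \<in> topspace X" using p by (simp add: one_skeleton_def)
  have "dim (\<tt> p) = dim (\<tt> q)"
    using skeleton_codim[OF p] q(2) unfolding codim_in_def by linarith
  then show ?thesis
    using subspace_dim_equal[OF subspace_inf_isotropy[OF q(1)] subspace_inf_isotropy[OF p'] q(3)] by simp
qed

end

section \<open>Compatible tuples along components of fixed point sets\<close>

locale skeleton_space = torus_space T X \<phi>
  for T :: "(complex ^ 'n) set" and X :: "'x topology" and \<phi> +
  fixes n :: nat and Z :: "nat \<Rightarrow> 'x set"
  assumes finite_inf_isotropies: "finite (inf_isotropies T X \<phi>)"
    and component_meets: "\<lbrakk>torus H; H \<subseteq> T; C \<in> components H\<rbrakk> \<Longrightarrow> C \<inter> Fix T \<noteq> {}"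
    and connected_skeleton: "\<lbrakk>torus H; H \<subseteq> T; C \<in> components H\<rbrakk> \<Longrightarrow> connectedin X (C \<inter> one_skeleton T X \<phi>)"
    and finite_codim_one: "\<lbrakk>\<gg> \<in> inf_isotropies T X \<phi>; codim_in T \<gg> = 1\<rbrakk>
           \<Longrightarrow> finite (connected_components_of (subtopology X (inf_fixed_points T X \<phi> \<gg>)))"
    and bij_Z: "bij_betw Z {1..n} (components T)"
begin

lemma Z_component: "j \<in> {1..n} \<Longrightarrow> Z j \<in> components T"
  using bij_Z by (auto simp: bij_betw_def)

lemma Z_nonempty: "j \<in> {1..n} \<Longrightarrow> Z j \<noteq> {}"
  using nonempty_connected_components_of[OF Z_component] .

lemma Z_subset: "j \<in> {1..n} \<Longrightarrow> Z j \<subseteq> Fix T"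
  using connected_components_of_subset[OF Z_component[of j]] by auto

lemma fixed_in_Z:
  assumes "p \<in> Fix T"
  obtains j where "j \<in> {1..n}" "p \<in> Z j"
proof -
  have "p \<in> \<Union>(components T)"
    using assms fixed_points_subset[of T] by (auto simp: Union_connected_components_of)
  also have "components T = Z ` {1..n}" using bij_Z by (simp add: bij_betw_def)
  finally show ?thesis using that by blast
qed

lemma Z_disjoint:
  assumes "i \<in> {1..n}" "j \<in> {1..n}" "p \<in> Z i" "p \<in> Z j"
  shows "i = j"
proof -
  have "Z i \<inter> Z j \<noteq> {}" using assms(3,4) by blast
  then have "Z i = Z j"
    using connected_components_of_overlap[OF Z_component[OF assms(1)] Z_component[OF assms(2)]] by simp
  then show ?thesis using bij_Z assms(1,2) unfolding bij_betw_def by (blast dest: inj_onD)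
qed

lemma connectedin_fixed_points_mono:
  "\<lbrakk>connectedin (subtopology X (Fix K)) C; H \<subseteq> K\<rbrakk> \<Longrightarrow> connectedin (subtopology X (Fix H)) C"
  using fixed_points_antimono[of H K] by (auto simp: connectedin_subtopology)

text \<open>A larger torus has a smaller fixed point set, so its components lie inside those for a smaller torus.\<close>
lemma component_subset:
  assumes "H \<subseteq> K" "C \<in> components H" "D \<in> components K" "p \<in> C" "p \<in> D"
  shows "D \<subseteq> C"
proof (rule connected_components_of_maximal[OF assms(2)])
  show "connectedin (subtopology X (Fix H)) D"
    using connectedin_connected_components_of[OF assms(3)] assms(1) by (rule connectedin_fixed_points_mono)
  show "\<not> disjnt C D" using assms(4,5) by (auto simp: disjnt_def)
qed

lemma component_contains_Z:
  assumes "torus H" "H \<subseteq> T" "C \<in> components H"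
  obtains j where "j \<in> {1..n}" "Z j \<subseteq> C"
proof -
  obtain p where p: "p \<in> C" "p \<in> Fix T" using component_meets[OF assms] by blast
  then obtain j where "j \<in> {1..n}" "p \<in> Z j" using fixed_in_Z by blast
  then show ?thesis using that component_subset[OF assms(2,3) Z_component[of j] p(1)] by blast
qed

text \<open>Each component contains some \<open>Z j\<close>, and distinct components contain distinct ones.\<close>
lemma finite_components:
  assumes "torus H" "H \<subseteq> T"
  shows "finite (components H)"
proof -
  have "\<exists>j. j \<in> {1..n} \<and> Z j \<subseteq> C" if "C \<in> components H" for C
    using component_contains_Z[OF assms that] by blast
  then obtain j where j: "\<And>C. C \<in> components H \<Longrightarrow> j C \<in> {1..n} \<and> Z (j C) \<subseteq> C" by metis
  have "inj_on j (components H)"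
  proof (rule inj_onI)
    fix C D assume C: "C \<in> components H" and D: "D \<in> components H" and eq: "j C = j D"
    then have "Z (j C) \<subseteq> C \<inter> D" "Z (j C) \<noteq> {}" using j[OF C] j[OF D] Z_nonempty by auto
    then show "C = D" using connected_components_of_overlap[OF C D] by blast
  qed
  moreover have "j ` components H \<subseteq> {1..n}" using j by blast
  ultimately show ?thesis using finite_imageD finite_subset by blast
qed

text \<open>The component along which an assignment is constant in its whole value at \<open>p\<close>: on it, every infinitesimal
isotropy contains \<open>\<tt> p\<close>.\<close>
definition isotropy_component :: "'x \<Rightarrow> 'x set" where
  "isotropy_component p = connected_component_of_set (subtopology X (Fix (iso_torus p))) p"

lemma isotropy_component: assumes "p \<in> topspace X" shows "isotropy_component p \<in> components (iso_torus p)" "p \<in> isotropy_component p"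
proof -
  have "p \<in> topspace (subtopology X (Fix (iso_torus p)))" using iso_torus[OF assms] assms by simp
  then show "isotropy_component p \<in> components (iso_torus p)" "p \<in> isotropy_component p"
    unfolding isotropy_component_def by (auto simp: connected_components_of_def connected_component_of_refl)
qed

text \<open>The choice among the indices \<open>j\<close> is arbitrary; for compatible tuples it does not affect \<open>f j\<close> on \<open>\<tt> p\<close>.\<close>
definition component_label :: "'x \<Rightarrow> nat" where
  "component_label p = (SOME j. j \<in> {1..n} \<and> Z j \<subseteq> isotropy_component p)"

lemma component_label:
  assumes "p \<in> topspace X"
  shows "component_label p \<in> {1..n}" "Z (component_label p) \<subseteq> isotropy_component p"
proof -
  have "\<exists>j. j \<in> {1..n} \<and> Z j \<subseteq> isotropy_component p"
    using component_contains_Z[OF iso_torus(1,2) isotropy_component(1)] assms by metis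
  then show "component_label p \<in> {1..n}" "Z (component_label p) \<subseteq> isotropy_component p"
    using someI_ex[of "\<lambda>j. j \<in> {1..n} \<and> Z j \<subseteq> isotropy_component p"] unfolding component_label_def by blast+
qed

lemma component_label_fixed:
  assumes j: "j \<in> {1..n}" "p \<in> Z j"
  shows "component_label p = j"
proof -
  have p: "p \<in> Fix T" "p \<in> topspace X" using Z_subset[OF j(1)] j(2) fixed_points_subset by auto
  have "isotropy_component p \<subseteq> Z j"
    using component_subset[OF order_refl Z_component[OF j(1)] _ j(2) isotropy_component(2)[OF p(2)]]
      isotropy_component(1)[OF p(2)] iso_torus_fixed[OF p(1)] by simp
  then have "Z (component_label p) \<subseteq> Z j" using component_label[OF p(2)] by blast
  then show ?thesis using Z_disjoint[OF component_label(1)[OF p(2)] j(1)] Z_nonempty[OF component_label(1)[OF p(2)]] by blast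
qed

lemma compatible_at:
  assumes f: "f \<in> compatible_tuples T X \<phi> n Z" and q: "q \<in> topspace X" "codim_in T (\<tt> q) = 1"
    and D: "D \<in> components (iso_torus q)" "i \<in> {1..n}" "j \<in> {1..n}" "Z i \<subseteq> D" "Z j \<subseteq> D" and v: "v \<in> \<tt> q"
  shows "f i v = f j v"
proof -
  have "\<tt> q \<in> inf_isotropies T X \<phi>" using q(1) by (simp add: inf_isotropies_def)
  moreover have "D \<in> connected_components_of (subtopology X (inf_fixed_points T X \<phi> (\<tt> q)))"
    using D(1) inf_fixed_points_eq[OF q(1)] by simp
  ultimately have "f i v - f j v = 0"
    using f q(2) D(2-) v unfolding compatible_tuples_def by blast
  then show ?thesis by simp
qed

text \<open>A point of \<open>D\<close> is either fixed by \<open>T\<close>, and then its label names the \<open>Z j\<close> through it, or it has the isotropy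
\<open>\<tt> q\<close>, and then \<open>D\<close> is its own component.\<close>
lemma component_label_in_codim_one_component:
  assumes q: "q \<in> topspace X" "codim_in T (\<tt> q) = 1" and D: "D \<in> components (iso_torus q)"
    and p: "p \<in> D" "p \<in> one_skeleton T X \<phi>"
  shows "Z (component_label p) \<subseteq> D"
proof (cases "p \<in> Fix T")
  case True
  then obtain j where j: "j \<in> {1..n}" "p \<in> Z j" using fixed_in_Z by blast
  then show ?thesis
    using component_subset[OF iso_torus(2)[OF q(1)] D Z_component[OF j(1)] p(1) j(2)]
      component_label_fixed[OF j] by simp
next
  case False
  have p': "p \<in> topspace X" using p(2) by (simp add: one_skeleton_def)
  have "p \<in> Fix (iso_torus q)" using p(1) connected_components_of_subset[OF D] by auto
  then have "\<tt> q \<subseteq> \<tt> p" by (simp add: fixed_points_torus iso_torus q)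
  then have "\<tt> p = \<tt> q" using codim_one_skeleton[OF p(2) False q] by simp
  then have "iso_torus p = iso_torus q" by (simp add: iso_torus_def)
  then have "isotropy_component p \<subseteq> D"
    using component_subset[OF order_refl D _ p(1) isotropy_component(2)[OF p']] isotropy_component(1)[OF p'] by simp
  then show ?thesis using component_label(2)[OF p'] by blast
qed

text \<open>The polynomial \<open>f (component_label p)\<close> restricted to \<open>lie H\<close> is followed along \<open>C \<inter> one_skeleton T X \<phi>\<close>. This set
is connected, and on each member of the finite closed cover \<open>\<D>\<close> the restricted polynomial is constant: on a
component of the fixed point set of \<open>T\<close> the label itself is constant, and on a component belonging to a
codimension one isotropy \<open>\<gg>\<close> compatibility gives agreement on \<open>\<gg>\<close>, which contains \<open>lie H\<close>.\<close>
lemma compatible_tuple_on_component: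
  assumes f: "f \<in> compatible_tuples T X \<phi> n Z" and H: "torus H" "H \<subseteq> T"
    and C: "C \<in> components H" and ij: "i \<in> {1..n}" "j \<in> {1..n}" "Z i \<subseteq> C" "Z j \<subseteq> C"
  shows "restrict (f i) (lie H) = restrict (f j) (lie H)"
proof -
  \<comment> \<open>Isotropies that do not contain \<open>lie H\<close> are left out: compatibility along their components says nothing
    about all of \<open>lie H\<close>. A point of \<open>C\<close> outside the fixed point set of \<open>T\<close> is still covered, since \<open>H\<close> fixes it.\<close>
  define G where "G = {\<gg> \<in> inf_isotropies T X \<phi>. codim_in T \<gg> = 1 \<and> lie H \<subseteq> \<gg>}"
  define \<D> where "\<D> = components T \<union> (\<Union>\<gg>\<in>G. connected_components_of (subtopology X (inf_fixed_points T X \<phi> \<gg>)))"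
  have \<D>_cases: "D \<in> components T \<or> (\<exists>q\<in>topspace X. codim_in T (\<tt> q) = 1 \<and> lie H \<subseteq> \<tt> q \<and> D \<in> components (iso_torus q))"
    if "D \<in> \<D>" for D
    using that by (auto simp: \<D>_def G_def inf_isotropies_def inf_fixed_points_eq)
  have finite: "finite \<D>"
    unfolding \<D>_def G_def using finite_inf_isotropies finite_codim_one finite_components[OF torus_T order_refl]
    by auto
  have closed: "closedin X D" if "D \<in> \<D>" for D
    using \<D>_cases[OF that] closedin_component[OF order_refl] closedin_component[OF iso_torus(2)] by blast
  have cover: "C \<inter> one_skeleton T X \<phi> \<subseteq> \<Union>\<D>"
  proof
    fix p assume p: "p \<in> C \<inter> one_skeleton T X \<phi>"
    then have p': "p \<in> topspace X" by (simp add: one_skeleton_def)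
    show "p \<in> \<Union>\<D>"
    proof (cases "p \<in> Fix T")
      case True
      then show ?thesis using fixed_in_Z Z_component unfolding \<D>_def by (metis UnCI UnionI)
    next
      case False
      have "p \<in> Fix H" using p connected_components_of_subset[OF C] by auto
      then have "\<tt> p \<in> G"
        using skeleton_codim[OF _ False] p p' fixed_points_torus[OF H(1)]
        by (auto simp: G_def inf_isotropies_def)
      moreover have "isotropy_component p \<in> connected_components_of (subtopology X (inf_fixed_points T X \<phi> (\<tt> p)))"
        using isotropy_component(1)[OF p'] by (simp add: inf_fixed_points_eq[OF p'])
      ultimately have "isotropy_component p \<in> \<D>" unfolding \<D>_def by blast
      then show ?thesis using isotropy_component(2)[OF p'] by blast
    qed
  qed
  have const: "restrict (f (component_label p)) (lie H) = restrict (f (component_label q)) (lie H)"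
    if D: "D \<in> \<D>" and pq: "p \<in> D \<inter> (C \<inter> one_skeleton T X \<phi>)" "q \<in> D \<inter> (C \<inter> one_skeleton T X \<phi>)" for D p q
    using \<D>_cases[OF D]
  proof
    assume "D \<in> components T"
    then have "D \<in> Z ` {1..n}" using bij_Z by (simp add: bij_betw_def)
    then obtain k where "k \<in> {1..n}" "D = Z k" by blast
    then show ?thesis using component_label_fixed[of k] pq by simp
  next
    assume "\<exists>x\<in>topspace X. codim_in T (\<tt> x) = 1 \<and> lie H \<subseteq> \<tt> x \<and> D \<in> components (iso_torus x)"
    then obtain x where x: "x \<in> topspace X" "codim_in T (\<tt> x) = 1" "lie H \<subseteq> \<tt> x" "D \<in> components (iso_torus x)"
      by blast
    have "p \<in> topspace X" "q \<in> topspace X" using pq by (simp_all add: one_skeleton_def)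
    moreover have "Z (component_label p) \<subseteq> D" "Z (component_label q) \<subseteq> D"
      using component_label_in_codim_one_component[OF x(1,2,4)] pq by simp_all
    ultimately show ?thesis
      using compatible_at[OF f x(1,2,4)] component_label(1) x(3) by (auto intro!: restrict_ext)
  qed
  obtain p q where pq: "p \<in> Z i" "q \<in> Z j" using Z_nonempty ij(1,2) by blast
  have "Fix T \<subseteq> one_skeleton T X \<phi>" by (auto simp: fixed_iff one_skeleton_def codim_in_def)
  then have "p \<in> C \<inter> one_skeleton T X \<phi>" "q \<in> C \<inter> one_skeleton T X \<phi>"
    using pq ij Z_subset by blast+
  then have "restrict (f (component_label p)) (lie H) = restrict (f (component_label q)) (lie H)"
    by (rule connectedin_finite_closed_cover_constant[where F = "\<lambda>x. restrict (f (component_label x)) (lie H)",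
        OF connected_skeleton[OF H C] finite _ cover, rotated 2]) (fact closed const)+
  then show ?thesis using component_label_fixed[OF ij(1) pq(1)] component_label_fixed[OF ij(2) pq(2)] by simp
qed

definition extension :: "(nat \<Rightarrow> real ^ 'n \<Rightarrow> real) \<Rightarrow> 'x \<Rightarrow> real ^ 'n \<Rightarrow> real" where
  "extension f = (\<lambda>p\<in>topspace X. restrict (f (component_label p)) (\<tt> p))"

text \<open>For \<open>x\<close> in a component \<open>C\<close> of the fixed point set of \<open>H\<close>, the torus \<open>iso_torus x\<close> contains \<open>H\<close>, so the component
that defines the label of \<open>x\<close> lies in \<open>C\<close>. Thus all values on \<open>C\<close> restrict on \<open>lie H\<close> to polynomials \<open>f j\<close> with
\<open>Z j \<subseteq> C\<close>, which agree there.\<close>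
lemma extension_assignment:
  assumes f: "f \<in> compatible_tuples T X \<phi> n Z"
  shows "extension f \<in> assignments T X \<phi>"
proof -
  have poly: "extension f p \<in> carrier (poly_algebra (\<tt> p))" if "p \<in> topspace X" for p
  proof -
    have "f (component_label p) \<in> carrier (poly_algebra (lie T))"
      using f component_label(1)[OF that] by (auto simp: compatible_tuples_def)
    then show ?thesis
      using ring_hom_closed[OF restrict_ring_hom_poly_algebra[OF inf_isotropy_subset_lie]] that
      by (simp add: extension_def)
  qed
  moreover have "locally_constant_on (subtopology X (Fix H)) (\<lambda>p. restrict (extension f p) (lie H))"
    if H: "torus H" "H \<subseteq> T" for H
  proof (rule locally_constant_on_finite_components[OF finite_components[OF H]])
    fix C p q assume C: "C \<in> components H" and pq: "p \<in> C" "q \<in> C"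
    have at: "restrict (extension f x) (lie H) = restrict (f (component_label x)) (lie H) \<and>
        component_label x \<in> {1..n} \<and> Z (component_label x) \<subseteq> C" if x: "x \<in> C" for x
    proof -
      have xH: "x \<in> Fix H" using x connected_components_of_subset[OF C] by auto
      then have x': "x \<in> topspace X" and sub: "lie H \<subseteq> \<tt> x" by (simp_all add: fixed_points_torus[OF H(1)])
      have "H \<subseteq> iso_torus x"
        using image_mono[OF sub, of torus_exp] torus_exp_lie_torus[OF H(1)] by (simp add: iso_torus_def)
      then have "isotropy_component x \<subseteq> C" using component_subset[OF _ C isotropy_component(1)[OF x'] x isotropy_component(2)[OF x']] by blast
      moreover have "restrict (extension f x) (lie H) = restrict (f (component_label x)) (lie H)"
        using x' sub by (simp add: extension_def Int_absorb1)
      ultimately show ?thesis using component_label[OF x'] by blast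
    qed
    show "restrict (extension f p) (lie H) = restrict (extension f q) (lie H)"
      using at[OF pq(1)] at[OF pq(2)] compatible_tuple_on_component[OF f H C] by simp
  qed
  ultimately show ?thesis by (auto simp: assignments_def extension_def)
qed

end

section \<open>Assignments on the fixed point set and the restriction homomorphism\<close>

lemma poly_algebra_restrict: "f \<in> carrier (poly_algebra V) \<Longrightarrow> restrict f V = f"
  by (auto simp: poly_algebra_def)

context torus_space
begin

abbreviation XT :: "'x topology" where "XT \<equiv> subtopology X (Fix T)"

abbreviation S :: "(real ^ 'n \<Rightarrow> real) ring" where "S \<equiv> poly_algebra (lie T)"

lemma topspace_Int_fixed [simp]: "topspace X \<inter> Fix H = Fix H"
  using fixed_points_subset[of H] by auto

lemma topspace_XT [simp]: "topspace XT = Fix T"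
  using fixed_points_subset[of T] by auto

lemma fixed_points_XT: "fixed_points T XT \<phi> H = Fix T \<inter> Fix H"
  using fixed_points_subset[of T] by (auto simp: fixed_points_def)

lemma inf_isotropy_fixed_point: "p \<in> Fix T \<Longrightarrow> \<tt> p = lie T"
  by (simp add: fixed_iff)

lemma restrict_assignment:
  assumes A: "A \<in> assignments T X \<phi>"
  shows "restrict A (Fix T) \<in> assignments T XT \<phi>"
proof -
  have "locally_constant_on (subtopology XT (fixed_points T XT \<phi> H)) (\<lambda>p. restrict (restrict A (Fix T) p) (lie H))"
    if H: "torus H" "H \<subseteq> T" for H
  proof -
    have "subtopology XT (fixed_points T XT \<phi> H) = subtopology (subtopology X (Fix H)) (Fix T)"
      by (simp add: subtopology_subtopology fixed_points_XT Int_ac)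
    then have "locally_constant_on (subtopology XT (fixed_points T XT \<phi> H)) (\<lambda>p. restrict (A p) (lie H))"
      using locally_constant_on_subtopology[OF assignments_locally_constant[OF A H], of "Fix T"] by simp
    from this this show ?thesis
      by (rule locally_constant_on_combine) (simp add: fixed_points_XT)
  qed
  moreover have "restrict A (Fix T) \<in> (\<Pi>\<^sub>E p \<in> topspace XT. carrier (poly_algebra (\<tt> p)))"
    using assignments_mem[OF A] fixed_points_subset[of T] by (auto simp: subset_iff)
  ultimately show ?thesis by (simp add: assignments_def)
qed

lemma restriction_algebra_hom:
  "(\<lambda>A. restrict A (Fix T)) \<in> algebra_hom S (assignment_algebra T X \<phi>) (assignment_algebra T XT \<phi>)"
proof -
  have sub: "p \<in> topspace X" if "p \<in> Fix T" for p using that fixed_points_subset by blast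
  show ?thesis
    unfolding algebra_hom_def
  proof (intro CollectI conjI ballI ring_hom_memI)
    fix A assume "A \<in> carrier (assignment_algebra T X \<phi>)"
    then show "restrict A (Fix T) \<in> carrier (assignment_algebra T XT \<phi>)"
      using restrict_assignment by (simp add: assignment_algebra_def)
  qed (unfold assignment_algebra_def topspace_XT,
      simp_all add: fun_eq_iff restrict_def sub)
qed

end

context skeleton_space
begin

text \<open>At a fixed point of \<open>T\<close> the infinitesimal isotropy is all of \<open>lie T\<close>, so the condition for \<open>H = T\<close> concerns
the whole value of the assignment.\<close>
lemma assignment_constant_on_Z:
  assumes A: "A \<in> assignments T XT \<phi>" and j: "j \<in> {1..n}" and pq: "p \<in> Z j" "q \<in> Z j"
  shows "A p = A q"
proof -
  have "subtopology XT (fixed_points T XT \<phi> T) = XT"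
    by (simp add: fixed_points_XT subtopology_subtopology)
  then have "locally_constant_on XT (\<lambda>p. restrict (A p) (lie T))"
    using assignments_locally_constant[OF A torus_T order_refl] by simp
  then have "restrict (A p) (lie T) = restrict (A q) (lie T)"
    using connectedin_connected_components_of[OF Z_component[OF j]] pq by (rule locally_constant_on_connectedin)
  moreover have "restrict (A x) (lie T) = A x" if x: "x \<in> Z j" for x
  proof -
    have "x \<in> Fix T" using x Z_subset[OF j] by blast
    then show ?thesis
      using assignments_mem[OF A, of x] by (simp add: poly_algebra_restrict inf_isotropy_fixed_point del: topspace_subtopology)
  qed
  ultimately show ?thesis using pq by simp
qed

lemma some_in_Z: "j \<in> {1..n} \<Longrightarrow> (SOME p. p \<in> Z j) \<in> Z j"
  using Z_nonempty by (simp add: some_in_eq)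

lemma some_in_Fix: "j \<in> {1..n} \<Longrightarrow> (SOME p. p \<in> Z j) \<in> Fix T"
  using some_in_Z Z_subset by blast

lemma component_values_at:
  assumes "A \<in> assignments T XT \<phi>" "j \<in> {1..n}" "p \<in> Z j"
  shows "A p = component_values n Z A j"
  using assignment_constant_on_Z[OF assms some_in_Z] assms(2) by (simp add: component_values_def)

text \<open>On the fixed point set the label is the index of the component, hence locally constant.\<close>
lemma assignment_of_tuple:
  assumes g: "g \<in> {1..n} \<rightarrow>\<^sub>E carrier S"
  shows "(\<lambda>p\<in>Fix T. g (component_label p)) \<in> assignments T XT \<phi>"
proof -
  have lab: "component_label p \<in> {1..n}" if "p \<in> Fix T" for p
    using component_label(1) that fixed_points_subset by blast
  have XT: "locally_constant_on XT component_label"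
  proof (rule locally_constant_on_finite_components[OF finite_components[OF torus_T order_refl]])
    fix C p q assume C: "C \<in> components T" "p \<in> C" "q \<in> C"
    then have "C \<in> Z ` {1..n}" using bij_Z by (simp add: bij_betw_def)
    then show "component_label p = component_label q" using C component_label_fixed by blast
  qed
  have "locally_constant_on (subtopology XT (fixed_points T XT \<phi> H)) (\<lambda>p. restrict ((\<lambda>p\<in>Fix T. g (component_label p)) p) (lie H))" for H
    using locally_constant_on_subtopology[OF XT] locally_constant_on_subtopology[OF XT]
    by (rule locally_constant_on_combine) (simp add: fixed_points_XT)
  moreover have "(\<lambda>p\<in>Fix T. g (component_label p)) \<in> (\<Pi>\<^sub>E p \<in> topspace XT. carrier (poly_algebra (\<tt> p)))"
    using g lab by (auto simp: inf_isotropy_fixed_point)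
  ultimately show ?thesis by (simp add: assignments_def)
qed

lemma component_values_algebra_hom:
  "component_values n Z \<in> algebra_hom S (assignment_algebra T XT \<phi>) (power_algebra {1..n} S)"
proof -
  show ?thesis
    unfolding algebra_hom_def
  proof (intro CollectI conjI ballI ring_hom_memI)
    fix A assume "A \<in> carrier (assignment_algebra T XT \<phi>)"
    then have "A p \<in> carrier S" if "p \<in> Fix T" for p
      using assignments_mem[of A T XT \<phi> p] that by (simp add: assignment_algebra_def inf_isotropy_fixed_point)
    then show "component_values n Z A \<in> carrier (power_algebra {1..n} S)"
      using some_in_Fix by (auto simp: power_algebra_def component_values_def)
  next
    fix a A assume "a \<in> carrier S"
    then show "component_values n Z (a \<odot>\<^bsub>assignment_algebra T XT \<phi>\<^esub> A) =
        a \<odot>\<^bsub>power_algebra {1..n} S\<^esub> component_values n Z A"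
      unfolding assignment_algebra_def power_algebra_def component_values_def topspace_XT
      using some_in_Fix by (simp add: inf_isotropy_fixed_point poly_algebra_restrict cong: restrict_cong)
  qed (unfold assignment_algebra_def power_algebra_def component_values_def topspace_XT,
      use some_in_Fix in \<open>simp_all add: inf_isotropy_fixed_point cong: restrict_cong\<close>)
qed

lemma component_values_algebra_iso:
  "component_values n Z \<in> algebra_iso S (assignment_algebra T XT \<phi>) (power_algebra {1..n} S)"
  unfolding algebra_iso_def
proof (intro CollectI conjI component_values_algebra_hom bij_betw_imageI)
  show "inj_on (component_values n Z) (carrier (assignment_algebra T XT \<phi>))"
  proof (rule inj_onI)
    fix A B assume "A \<in> carrier (assignment_algebra T XT \<phi>)" "B \<in> carrier (assignment_algebra T XT \<phi>)"
      and eq: "component_values n Z A = component_values n Z B"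
    then have A: "A \<in> assignments T XT \<phi>" and B: "B \<in> assignments T XT \<phi>"
      by (simp_all add: assignment_algebra_def)
    have "A p = B p" if p: "p \<in> Fix T" for p
    proof -
      obtain j where j: "j \<in> {1..n}" "p \<in> Z j" using fixed_in_Z[OF p] by blast
      show ?thesis using component_values_at[OF A j] component_values_at[OF B j] eq by simp
    qed
    moreover have "A \<in> extensional (Fix T)" "B \<in> extensional (Fix T)"
      using A B by (auto simp: assignments_def PiE_def)
    ultimately show "A = B" by (metis extensionalityI)
  qed
  show "component_values n Z ` carrier (assignment_algebra T XT \<phi>) = carrier (power_algebra {1..n} S)"
  proof
    show "component_values n Z ` carrier (assignment_algebra T XT \<phi>) \<subseteq> carrier (power_algebra {1..n} S)"
      using component_values_algebra_hom by (auto simp: algebra_hom_def ring_hom_closed)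
    show "carrier (power_algebra {1..n} S) \<subseteq> component_values n Z ` carrier (assignment_algebra T XT \<phi>)"
    proof
      fix g assume "g \<in> carrier (power_algebra {1..n} S)"
      then have g: "g \<in> {1..n} \<rightarrow>\<^sub>E carrier S" by (simp add: power_algebra_def)
      let ?A = "\<lambda>p\<in>Fix T. g (component_label p)"
      have "component_values n Z ?A j = g j" for j
      proof (cases "j \<in> {1..n}")
        case True
        then show ?thesis
          using component_label_fixed[OF True some_in_Z[OF True]] some_in_Fix[OF True] by (simp add: component_values_def)
      next
        case False
        then show ?thesis using PiE_arb[OF g False] by (auto simp: component_values_def)
      qed
      then have "g = component_values n Z ?A" by auto
      moreover have "?A \<in> carrier (assignment_algebra T XT \<phi>)"
        using assignment_of_tuple[OF g] by (simp add: assignment_algebra_def)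
      ultimately show "g \<in> component_values n Z ` carrier (assignment_algebra T XT \<phi>)" by (rule image_eqI)
    qed
  qed
qed

lemma assignment_constant_on_component:
  assumes "A \<in> assignments T X \<phi>" "torus H" "H \<subseteq> T" "C \<in> components H" "p \<in> C" "q \<in> C"
  shows "restrict (A p) (lie H) = restrict (A q) (lie H)"
  using assignments_locally_constant[OF assms(1-3)] connectedin_connected_components_of[OF assms(4)] assms(5,6)
  by (rule locally_constant_on_connectedin)

text \<open>The value at \<open>p\<close> is the restriction to \<open>\<tt> p\<close> of the value at a \<open>T\<close>-fixed point in the component belonging to \<open>p\<close>.\<close>
lemma restriction_inj_on: "inj_on (\<lambda>A. restrict A (Fix T)) (assignments T X \<phi>)"
proof (rule inj_onI)
  fix A B assume A: "A \<in> assignments T X \<phi>" and B: "B \<in> assignments T X \<phi>"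
    and eq: "restrict A (Fix T) = restrict B (Fix T)"
  have "A p = B p" if p: "p \<in> topspace X" for p
  proof -
    note iso = iso_torus[OF p]
    obtain q where q: "q \<in> isotropy_component p" "q \<in> Fix T"
      using component_meets[OF iso(1,2) isotropy_component(1)[OF p]] by blast
    have "A q = B q" using eq q(2) by (metis restrict_apply')
    then have "restrict (A p) (\<tt> p) = restrict (B p) (\<tt> p)"
      using assignment_constant_on_component[OF A iso(1,2) isotropy_component(1)[OF p] isotropy_component(2)[OF p] q(1)]
        assignment_constant_on_component[OF B iso(1,2) isotropy_component(1)[OF p] isotropy_component(2)[OF p] q(1)] iso(3) by simp
    then show ?thesis
      using assignments_mem[OF A p] assignments_mem[OF B p] by (simp add: poly_algebra_restrict)
  qed
  moreover have "A \<in> extensional (topspace X)" "B \<in> extensional (topspace X)"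
    using A B by (auto simp: assignments_def PiE_def)
  ultimately show "A = B" by (metis extensionalityI)
qed

lemma component_values_restriction:
  assumes "j \<in> {1..n}"
  shows "component_values n Z (restrict A (Fix T)) j = A (SOME p. p \<in> Z j)"
  using assms some_in_Fix by (simp add: component_values_def)

text \<open>The inclusion from left to right is constancy along components for the torus with Lie algebra \<open>\<gg>\<close>; the
converse is the extension of a compatible tuple, whose label at a point of \<open>Z j\<close> is \<open>j\<close>.\<close>
lemma image_restriction:
  "(\<lambda>A. component_values n Z (restrict A (Fix T))) ` assignments T X \<phi> = compatible_tuples T X \<phi> n Z"
proof
  show "(\<lambda>A. component_values n Z (restrict A (Fix T))) ` assignments T X \<phi> \<subseteq> compatible_tuples T X \<phi> n Z"
  proof
    fix f assume "f \<in> (\<lambda>A. component_values n Z (restrict A (Fix T))) ` assignments T X \<phi>"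
    then obtain A where A: "A \<in> assignments T X \<phi>" and f: "f = component_values n Z (restrict A (Fix T))"
      by blast
    have "f \<in> {1..n} \<rightarrow>\<^sub>E carrier S"
    proof (rule PiE_I)
      fix j assume j: "j \<in> {1..n}"
      have "(SOME p. p \<in> Z j) \<in> topspace X" using some_in_Fix[OF j] fixed_points_subset by blast
      then show "f j \<in> carrier S"
        using assignments_mem[OF A] some_in_Fix[OF j]
        by (simp add: f component_values_restriction[OF j] flip: inf_isotropy_fixed_point)
    qed (auto simp: f component_values_def)
    moreover have "f i v - f j v = 0"
      if g: "\<gg> \<in> inf_isotropies T X \<phi>" "C \<in> connected_components_of (subtopology X (inf_fixed_points T X \<phi> \<gg>))"
        "i \<in> {1..n}" "j \<in> {1..n}" "Z i \<subseteq> C" "Z j \<subseteq> C" "v \<in> \<gg>" for \<gg> C i j v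
    proof -
      obtain x where x: "x \<in> topspace X" "\<gg> = \<tt> x" using g(1) by (auto simp: inf_isotropies_def)
      then have C: "C \<in> components (iso_torus x)" using g(2) by (simp add: inf_fixed_points_eq)
      have "restrict (f i) (\<tt> x) = restrict (f j) (\<tt> x)"
        using assignment_constant_on_component[OF A iso_torus(1,2)[OF x(1)] C] some_in_Z g(3-6)
        by (simp add: f component_values_restriction iso_torus(3)[OF x(1)] subset_iff)
      then have "f i v = f j v" using g(7) x(2) by (metis restrict_apply')
      then show ?thesis by simp
    qed
    ultimately show "f \<in> compatible_tuples T X \<phi> n Z" unfolding compatible_tuples_def by blast
  qed
  show "compatible_tuples T X \<phi> n Z \<subseteq> (\<lambda>A. component_values n Z (restrict A (Fix T))) ` assignments T X \<phi>"
  proof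
    fix f assume f: "f \<in> compatible_tuples T X \<phi> n Z"
    then have fS: "f \<in> {1..n} \<rightarrow>\<^sub>E carrier S" by (simp add: compatible_tuples_def)
    have "component_values n Z (restrict (extension f) (Fix T)) j = f j" for j
    proof (cases "j \<in> {1..n}")
      case True
      let ?p = "SOME p. p \<in> Z j"
      have p: "?p \<in> topspace X" "?p \<in> Fix T" using some_in_Fix[OF True] fixed_points_subset by blast+
      have "f j \<in> carrier S" using fS True by auto
      then show ?thesis
        using component_label_fixed[OF True some_in_Z[OF True]] p
        by (simp add: component_values_restriction[OF True] extension_def inf_isotropy_fixed_point poly_algebra_restrict)
    next
      case False
      then show ?thesis using PiE_arb[OF fS False] by (auto simp: component_values_def)
    qed
    then have "f = component_values n Z (restrict (extension f) (Fix T))" by auto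
    then show "f \<in> (\<lambda>A. component_values n Z (restrict A (Fix T))) ` assignments T X \<phi>"
      using extension_assignment[OF f] by (rule image_eqI)
  qed
qed

end

lemma subalgebra_compatible_tuples:
  "subalgebra_of (poly_algebra (lie T)) (compatible_tuples T X \<phi> n Z) (power_algebra {1..n} (poly_algebra (lie T)))"
proof (rule subalgebra_ofI[OF algebra_power_algebra[OF cring_poly_algebra]])
  let ?S = "poly_algebra (lie T)" and ?K = "compatible_tuples T X \<phi> n Z"
  let ?P = "power_algebra {1..n} ?S"
  interpret P: Module.algebra ?S ?P by (rule algebra_power_algebra[OF cring_poly_algebra])
  note P_closed = ring.ring_simprules(1,5,6)[OF cring.axioms(1)[OF P.M_cring]]
  have iso: "\<gg> \<subseteq> lie T" if "\<gg> \<in> inf_isotropies T X \<phi>" for \<gg>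
    using that inf_isotropy_subset_lie[of T \<phi>] unfolding inf_isotropies_def by blast
  show carr: "?K \<subseteq> carrier ?P" by (auto simp: compatible_tuples_def power_algebra_def)
  have memI: "f \<in> ?K" if f: "f \<in> carrier ?P"
    and eq: "\<And>\<gg> C i j v. \<lbrakk>\<gg> \<in> inf_isotropies T X \<phi>; codim_in T \<gg> = 1;
       C \<in> connected_components_of (subtopology X (inf_fixed_points T X \<phi> \<gg>));
       i \<in> {1..n}; j \<in> {1..n}; Z i \<subseteq> C; Z j \<subseteq> C; v \<in> \<gg>; v \<in> lie T\<rbrakk> \<Longrightarrow> f i v = f j v" for f
  proof -
    have "f i v - f j v = 0"
      if h: "\<gg> \<in> inf_isotropies T X \<phi>" "codim_in T \<gg> = 1"
       "C \<in> connected_components_of (subtopology X (inf_fixed_points T X \<phi> \<gg>))"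
       "i \<in> {1..n}" "j \<in> {1..n}" "Z i \<subseteq> C" "Z j \<subseteq> C" "v \<in> \<gg>" for \<gg> C i j v
      using eq[OF h] iso[OF h(1)] h(8) by auto
    moreover have "f \<in> {1..n} \<rightarrow>\<^sub>E carrier ?S" using f by (simp add: power_algebra_def)
    ultimately show ?thesis unfolding compatible_tuples_def by blast
  qed
  have memD: "f i v = f j v" if "f \<in> ?K" "\<gg> \<in> inf_isotropies T X \<phi>" "codim_in T \<gg> = 1"
       "C \<in> connected_components_of (subtopology X (inf_fixed_points T X \<phi> \<gg>))"
       "i \<in> {1..n}" "j \<in> {1..n}" "Z i \<subseteq> C" "Z j \<subseteq> C" "v \<in> \<gg>" for f \<gg> C i j v
  proof -
    have "f i v - f j v = 0" using that unfolding compatible_tuples_def by blast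
    then show ?thesis by simp
  qed
  have at: "(f \<oplus>\<^bsub>?P\<^esub> g) i v = f i v + g i v" "(f \<otimes>\<^bsub>?P\<^esub> g) i v = f i v * g i v"
      "\<one>\<^bsub>?P\<^esub> i v = 1" "(a \<odot>\<^bsub>?P\<^esub> f) i v = a v * f i v"
    if "i \<in> {1..n}" "v \<in> lie T" for f g a i v
    using that by (simp_all add: power_algebra_def poly_algebra_def)
  show "\<one>\<^bsub>?P\<^esub> \<in> ?K" by (rule memI) (rule P_closed, simp only: at)
  show "f \<oplus>\<^bsub>?P\<^esub> g \<in> ?K" if "f \<in> ?K" "g \<in> ?K" for f g
  proof (rule memI)
    show "f \<oplus>\<^bsub>?P\<^esub> g \<in> carrier ?P" using that carr by (blast intro: P_closed)
  qed (simp only: at, use memD[OF that(1)] memD[OF that(2)] in metis)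
  show "f \<otimes>\<^bsub>?P\<^esub> g \<in> ?K" if "f \<in> ?K" "g \<in> ?K" for f g
  proof (rule memI)
    show "f \<otimes>\<^bsub>?P\<^esub> g \<in> carrier ?P" using that carr by (blast intro: P_closed)
  qed (simp only: at, use memD[OF that(1)] memD[OF that(2)] in metis)
  show "a \<odot>\<^bsub>?P\<^esub> f \<in> ?K" if "a \<in> carrier ?S" "f \<in> ?K" for a f
  proof (rule memI)
    show "a \<odot>\<^bsub>?P\<^esub> f \<in> carrier ?P" using that carr by (blast intro: P.smult_closed)
  qed (simp only: at, use memD[OF that(2)] in metis)
qed

theorem theorem5p4:
  fixes T :: "(complex ^ 'n) set"
    and X :: "'x topology"
    and \<phi> :: "complex ^ 'n \<Rightarrow> 'x \<Rightarrow> 'x"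
    and n :: nat
    and Z :: "nat \<Rightarrow> 'x set"
  defines "XT \<equiv> subtopology X (fixed_points T X \<phi> T)"
    and "S \<equiv> poly_algebra (lie T)"
    and "r \<equiv> (\<lambda>A. restrict A (fixed_points T X \<phi> T))"
  assumes "torus T"
    and "Hausdorff_space X"
    and "connected_space X"
    and "continuous_torus_action T X \<phi>"
    and "finite (inf_isotropies T X \<phi>)"
    and "\<And>H C. \<lbrakk>torus H; H \<subseteq> T; C \<in> connected_components_of (subtopology X (fixed_points T X \<phi> H))\<rbrakk>
           \<Longrightarrow> C \<inter> fixed_points T X \<phi> T \<noteq> {} \<and> connectedin X (C \<inter> one_skeleton T X \<phi>)"
    and "finite (connected_components_of XT)"
    and "\<And>\<gg>. \<lbrakk>\<gg> \<in> inf_isotropies T X \<phi>; codim_in T \<gg> = 1\<rbrakk>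
           \<Longrightarrow> finite (connected_components_of (subtopology X (inf_fixed_points T X \<phi> \<gg>)))"
    and "bij_betw Z {1..n} (connected_components_of XT)"
  shows "Module.algebra S (assignment_algebra T X \<phi>)
       \<and> Module.algebra S (assignment_algebra T XT \<phi>)
       \<and> Module.algebra S (power_algebra {1..n} S)
       \<and> r \<in> algebra_hom S (assignment_algebra T X \<phi>) (assignment_algebra T XT \<phi>)
       \<and> inj_on r (carrier (assignment_algebra T X \<phi>))
       \<and> component_values n Z \<in> algebra_iso S (assignment_algebra T XT \<phi>) (power_algebra {1..n} S)
       \<and> (\<forall>A \<in> carrier (assignment_algebra T XT \<phi>). \<forall>j \<in> {1..n}. \<forall>p \<in> Z j.
            A p = component_values n Z A j)
       \<and> component_values n Z ` r ` carrier (assignment_algebra T X \<phi>) = compatible_tuples T X \<phi> n Z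
       \<and> subalgebra_of S (compatible_tuples T X \<phi> n Z) (power_algebra {1..n} S)"
proof -
  interpret skeleton_space T X \<phi> n Z
    by unfold_locales (fact assms(4,5,7,8,11) assms(9)[THEN conjunct1] assms(9)[THEN conjunct2]
        assms(12)[unfolded XT_def])+
  have carrier: "carrier (assignment_algebra T Y \<phi>) = assignments T Y \<phi>" for Y :: "'x topology"
    by (simp add: assignment_algebra_def)
  show ?thesis
    unfolding XT_def S_def r_def carrier image_image
    by (intro conjI ballI algebra_assignment_algebra algebra_power_algebra cring_poly_algebra
        restriction_algebra_hom restriction_inj_on component_values_algebra_iso component_values_at
        image_restriction subalgebra_compatible_tuples)
qed

end
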